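(* Let $\lambda=(\lambda_1,\dots,\lambda_m)$ be a partition of length $m$ and let $n\ge m-1$. Then $$Q_\lambda(1^{n+1})=(2n+2)^m\sum_{k_1,\dots,k_m=0}^n\ \prod_{1\le i<j\le m}\frac{k_i-k_j}{k_i+k_j+1}\prod_{i=1}^m\frac{\left(-n,\,n+2,\,(1-\lambda_i)/2\right)_{k_i}}{(1,1,3/2)_{k_i}}.$$
   Context: $(a)_k=a(a+1)\cdots(a+k-1)$ and $(a,b,c)_k=(a)_k(b)_k(c)_k$. A partition of length $m$ is a sequence of integers $\lambda_1\ge\dots\ge\lambda_m>0$. For $m\le N$, the Schur $Q$-polynomial is the symmetric polynomial $$Q_\lambda(x_1,\dots,x_N)=2^m\sum_{\sigma\in S_N/S_{N-m}}\sigma\Bigg(x_1^{\lambda_1}\cdots x_m^{\lambda_m}\prod_{\substack{1\le i\le m\\ i<j\le N}}\frac{x_i+x_j}{x_i-x_j}\Bigg),$$ where $S_N$ acts by permuting the variables and $S_{N-m}$ is the subgroup permuting $x_{m+1},\dots,x_N$. $Q_\lambda(1^N)$ is its value at $x_1=\dots=x_N=1$; here $N=n+1$. *)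

theory Defs
  imports
    Complex_Main
    "HOL-Library.Poly_Mapping"
    "HOL-Library.FuncSet"
    "HOL-Combinatorics.Permutations"
    "HOL-Computational_Algebra.Fraction_Field"
begin

section \<open>Multivariate polynomials\<close>

text \<open>
  Polynomials over the reals in the variables \<open>x\<^sub>0, x\<^sub>1, \<dots>\<close> are finitely supported functions
  from monomials (finitely supported exponent vectors) to coefficients; multiplication of
  \<^typ>\<open>_ \<Rightarrow>\<^sub>0 _\<close> is convolution.  Indices are zero-based throughout, so the variables
  \<open>x\<^sub>1, \<dots>, x\<^sub>N\<close> become \<open>x\<^sub>0, \<dots>, x\<^bsub>N-1\<^esub>\<close> and \<open>\<lambda>\<^sub>1, \<dots>, \<lambda>\<^sub>m\<close> become \<open>la ! 0, \<dots>, la ! (m - 1)\<close>.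
\<close>

type_synonym mvpoly = "(nat \<Rightarrow>\<^sub>0 nat) \<Rightarrow>\<^sub>0 real"

definition mvar :: "nat \<Rightarrow> mvpoly" where
  "mvar i = Poly_Mapping.single (Poly_Mapping.single i 1) 1"

definition mveval :: "mvpoly \<Rightarrow> (nat \<Rightarrow> real) \<Rightarrow> real" where
  "mveval P x = (\<Sum>e \<in> Poly_Mapping.keys P. Poly_Mapping.lookup P e *
                   (\<Prod>i \<in> Poly_Mapping.keys e. x i ^ Poly_Mapping.lookup e i))"

definition to_ratfun :: "mvpoly \<Rightarrow> mvpoly fract" where
  "to_ratfun P = Fract P 1"


section \<open>Partitions and Schur Q-polynomials\<close>

definition is_partition :: "nat list \<Rightarrow> bool" where
  "is_partition la \<longleftrightarrow> sorted_wrt (\<ge>) la \<and> (\<forall>a \<in> set la. a > 0)"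

text \<open>
  The rational function in parentheses in the definition of \<open>Q\<^sub>\<lambda>\<close>, as an expression in \<open>x\<close>.
  A permutation \<open>\<sigma>\<close> sends the variable \<open>x i\<close> to \<open>x (\<sigma> i)\<close>, so that \<open>\<sigma>\<close> applied to
  \<open>schur_Q_term la N x\<close> is \<open>schur_Q_term la N (x \<circ> \<sigma>)\<close>.
\<close>

definition schur_Q_term :: "nat list \<Rightarrow> nat \<Rightarrow> (nat \<Rightarrow> mvpoly fract) \<Rightarrow> mvpoly fract" where
  "schur_Q_term la N x =
     (\<Prod>i<length la. x i ^ (la ! i)) *
     (\<Prod>i<length la. \<Prod>j \<in> {i<..<N}. (x i + x j) / (x i - x j))"

text \<open>
  The left cosets in \<open>S\<^sub>N / S\<^bsub>N-m\<^esub>\<close>, where \<open>S\<^bsub>N-m\<^esub>\<close> permutes the indices \<open>m, \<dots>, N - 1\<close>.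
\<close>

definition sym_cosets :: "nat \<Rightarrow> nat \<Rightarrow> (nat \<Rightarrow> nat) set set" where
  "sym_cosets m N =
     (\<lambda>\<sigma>. (\<lambda>\<tau>. \<sigma> \<circ> \<tau>) ` {\<tau>. \<tau> permutes {m..<N}}) ` {\<sigma>. \<sigma> permutes {..<N}}"

text \<open>
  The summand of a coset \<open>C\<close> is the common value of \<open>\<sigma>(\<dots>)\<close> for \<open>\<sigma> \<in> C\<close>; see
  \<open>schur_Q_summand_coset\<close> below for independence of the representative.
\<close>

definition schur_Q_summand :: "nat list \<Rightarrow> nat \<Rightarrow> (nat \<Rightarrow> nat) set \<Rightarrow> mvpoly fract" where
  "schur_Q_summand la N C =
     the_elem ((\<lambda>\<sigma>. schur_Q_term la N ((\<lambda>i. to_ratfun (mvar i)) \<circ> \<sigma>)) ` C)"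

definition schur_Q_ratfun :: "nat list \<Rightarrow> nat \<Rightarrow> mvpoly fract" where
  "schur_Q_ratfun la N =
     2 ^ length la * (\<Sum>C \<in> sym_cosets (length la) N. schur_Q_summand la N C)"

text \<open>
  The sum of rational functions above is a polynomial when \<open>length la \<le> N\<close>; it has to be taken as
  a polynomial before it can be evaluated at points with coinciding coordinates.
\<close>

definition schur_Q :: "nat list \<Rightarrow> nat \<Rightarrow> mvpoly" where
  "schur_Q la N = (THE P. to_ratfun P = schur_Q_ratfun la N)"

lemma to_ratfun_inject: "to_ratfun P = to_ratfun P' \<longleftrightarrow> P = P'"
  by (simp add: to_ratfun_def eq_fract)

lemma schur_Q_eqI: "to_ratfun P = schur_Q_ratfun la N \<Longrightarrow> schur_Q la N = P"
  unfolding schur_Q_def by (rule the_equality) (auto simp flip: to_ratfun_inject)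

lemma schur_Q_term_permute:
  assumes \<tau>: "\<tau> permutes {length la..<N}"
  shows "schur_Q_term la N (x \<circ> \<tau>) = schur_Q_term la N x"
proof -
  let ?m = "length la"
  have fixd: "\<tau> i = i" if "i < ?m" for i
    using \<tau> that by (auto simp: permutes_def)
  have img: "(\<Prod>j \<in> {i<..<N}. (x i + x (\<tau> j)) / (x i - x (\<tau> j))) =
             (\<Prod>j \<in> {i<..<N}. (x i + x j) / (x i - x j))" if i: "i < ?m" for i
  proof -
    have "\<tau> permutes {i<..<N}"
      by (rule permutes_subset[OF \<tau>]) (use i in auto)
    from prod.permute[OF this, of "\<lambda>j. (x i + x j) / (x i - x j)"]
    show ?thesis by (simp add: o_def)
  qed
  show ?thesis
    unfolding schur_Q_term_def by (simp add: fixd img)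
qed

lemma schur_Q_summand_coset:
  assumes "\<sigma> permutes {..<N}"
  shows "schur_Q_summand la N ((\<lambda>\<tau>. \<sigma> \<circ> \<tau>) ` {\<tau>. \<tau> permutes {length la..<N}}) =
         schur_Q_term la N (\<lambda>i. to_ratfun (mvar (\<sigma> i)))"
proof -
  let ?x = "\<lambda>i. to_ratfun (mvar i)"
  have "(\<lambda>\<rho>. schur_Q_term la N (?x \<circ> \<rho>)) ` (\<lambda>\<tau>. \<sigma> \<circ> \<tau>) ` {\<tau>. \<tau> permutes {length la..<N}}
        = {schur_Q_term la N (?x \<circ> \<sigma>)}"
    unfolding image_image
    using schur_Q_term_permute[of _ la N "?x \<circ> \<sigma>"] permutes_id[of "{length la..<N}"]
    by (auto simp: comp_assoc[symmetric] intro!: image_eqI[where x = id])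
  then show ?thesis
    by (simp add: schur_Q_summand_def comp_def)
qed

end

theory Submission
  imports Defs "HOL-Computational_Algebra.Polynomial"
begin

text \<open>
  Both sides of the identity are sums over functions \<open>k\<close> from \<open>{..<m}\<close> into a finite index set \<open>I\<close>,
  with summand \<open>\<Prod>i. u i (k i)\<close> times the kernel \<open>\<Prod>i<j. (y (k i) - y (k j)) / (y (k i) + y (k j))\<close>.
  On the right the points are \<open>y k = k + 1/2\<close>.  On the left write \<open>A p\<close> for the product of
  \<open>(x p + x q) / (x p - x q)\<close> over all \<open>q \<noteq> p\<close>.  A coset in the definition of \<open>Q\<^sub>\<lambda>\<close> is an injection
  \<open>s\<close> of \<open>{..<m}\<close> into \<open>{..<N}\<close>; its summand is \<open>\<Prod>i. 2 * A (s i) * x (s i) ^ \<lambda> i\<close> with the factors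
  for pairs inside the range of \<open>s\<close> corrected, and the correction is the kernel at the points
  \<open>y p = 1 / x p\<close>.  The kernel vanishes when two points coincide, so the sum may be extended from
  injections to all functions.

  Schur's Pfaffian formula writes the kernel as the Pfaffian of its two-variable case, and it
  passes through the sums.  Hence every such sum is a Pfaffian built from its cases \<open>m = 1\<close> and
  \<open>m = 2\<close> (\<open>kernel_sum_eq_pfaffian\<close>), and only these two have to be compared.

  On the left, the one-variable sums \<open>q_coeff\<close> and the two-variable sums \<open>q_pair\<close> obey recursions
  with coefficients in the polynomial ring.  So they are polynomials, the Pfaffian formed from them
  is the polynomial \<open>Q\<^sub>\<lambda>\<close> (\<open>schur_Q_eq_pfaffian\<close>), and since evaluation is a ring homomorphism, the
  value at \<open>(1, \<dots>, 1)\<close> is the Pfaffian formed from their values \<open>q\<^sub>N(a)\<close> and \<open>q\<^sub>N(a, b)\<close> there.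

  These values satisfy \<open>2 a q\<^sub>N(a) = N (q\<^bsub>N+1\<^esub>(a) - q\<^bsub>N-1\<^esub>(a))\<close>, and with
  \<open>e(a) = (q\<^bsub>N+1\<^esub>(a) + q\<^bsub>N-1\<^esub>(a)) / 2\<close> also
  \<open>(a + b) q\<^sub>N(a, b) = a q\<^sub>N(a) e(b) - b q\<^sub>N(b) e(a)\<close>.  The hypergeometric sums satisfy the same two
  relations.  Neither relation shifts \<open>a\<close> or \<open>b\<close>, so each can be read off coefficientwise in the
  functions \<open>((1 - a)/2)\<^sub>k / k!\<close> of \<open>a\<close>, on which multiplication by \<open>a\<close> acts by a two-term rule.
  The first relation determines \<open>q\<^sub>N\<close> from \<open>q\<^sub>0\<close> and \<open>q\<^sub>1\<close>, the second then determines
  \<open>q\<^sub>N(a, b)\<close> for \<open>a + b > 0\<close>.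
\<close>

section \<open>Partial fractions\<close>

text \<open>
  The residue of \<open>\<Prod>i. (z + x i) / (z - x i)\<close> at \<open>z = x i\<close> is \<open>2 * x i * residue_coeff I x i\<close>.
\<close>

definition residue_coeff :: "'a set \<Rightarrow> ('a \<Rightarrow> 'b::field) \<Rightarrow> 'a \<Rightarrow> 'b" where
  "residue_coeff I x i = (\<Prod>j\<in>I - {i}. (x i + x j) / (x i - x j))"

text \<open>
  This is the partial fraction expansion of \<open>\<Prod>i. (z + x i) / (z - x i)\<close> with denominators cleared.
  The sides are polynomials in \<open>z\<close> that agree at the points \<open>x i\<close>, where one product vanishes and a
  single summand survives; they also agree in degree \<open>card I\<close>, where both coefficients are \<open>0\<close>.
\<close>

lemma prod_add_minus_prod_diff:
  fixes x :: "'a \<Rightarrow> 'b::field"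
  assumes fin: "finite I" and inj: "inj_on x I"
  shows "(\<Prod>i\<in>I. z + x i) - (\<Prod>i\<in>I. z - x i) =
         (\<Sum>i\<in>I. 2 * x i * residue_coeff I x i * (\<Prod>j\<in>I - {i}. z - x j))"
proof -
  define p where "p = (\<Prod>i\<in>I. [:x i, 1:])"
  define q where "q = (\<Prod>i\<in>I. [:- x i, 1:])"
  define r where "r = (\<Sum>i\<in>I. smult (2 * x i * residue_coeff I x i) (\<Prod>j\<in>I - {i}. [:- x j, 1:]))"
  have poly_r: "poly r w = (\<Sum>i\<in>I. 2 * x i * residue_coeff I x i * (\<Prod>j\<in>I - {i}. w - x j))" for w
    by (simp add: r_def poly_sum poly_prod algebra_simps)
  have deg_p: "degree p = card I" and deg_q: "degree q = card I"
    by (simp_all add: p_def q_def degree_prod_eq_sum_degree)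
  have deg_r: "degree r < card I" if "I \<noteq> {}"
    unfolding r_def
  proof (rule degree_sum_less)
    show "0 < card I" using that fin by (simp add: card_gt_0_iff)
  next
    fix i assume "i \<in> I"
    then have "card (I - {i}) < card I" using fin by (intro psubset_card_mono) auto
    moreover have "degree (smult c (\<Prod>j\<in>I - {i}. [:- x j, 1:])) \<le> card (I - {i})" for c
      by (rule order.trans[OF degree_smult_le]) (simp add: degree_prod_eq_sum_degree)
    ultimately show "degree (smult (2 * x i * residue_coeff I x i) (\<Prod>j\<in>I - {i}. [:- x j, 1:])) < card I"
      by (meson le_less_trans)
  qed
  \<comment> \<open>With the second product moved to the other side, both sides have degree \<open>card I\<close>; equality of
    the leading coefficients compensates for having only \<open>card I\<close> interpolation points.\<close>
  have "p = q + r"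
  proof (cases "I = {}")
    case True
    then show ?thesis by (simp add: p_def q_def r_def)
  next
    case False
    show ?thesis
    proof (rule poly_eqI_degree_lead_coeff)
      show "degree p \<le> card I" "degree (q + r) \<le> card I"
        using deg_p deg_q deg_r[OF False] by (auto intro!: degree_add_le)
      have "coeff p (card I) = 1"
        using deg_p lead_coeff_prod[of "\<lambda>i. [:x i, 1:]" I] by (simp add: p_def)
      moreover have "coeff q (card I) = 1"
        using deg_q lead_coeff_prod[of "\<lambda>i. [:- x i, 1:]" I] by (simp add: q_def)
      moreover have "coeff r (card I) = 0"
        using deg_r[OF False] by (rule coeff_eq_0)
      ultimately show "coeff p (card I) = coeff (q + r) (card I)" by simp
    next
      show "card I \<le> card (x ` I)" using inj by (simp add: card_image)
    next
      fix w assume "w \<in> x ` I"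
      then obtain i where i: "i \<in> I" and w: "w = x i" by blast
      have nz: "(\<Prod>j\<in>I - {i}. x i - x j) \<noteq> 0"
        using i inj fin by (auto simp: inj_on_def)
      have "poly q w = 0"
        using i fin by (auto simp: q_def poly_prod w)
      moreover have "poly p w = 2 * x i * (\<Prod>j\<in>I - {i}. x i + x j)"
        using i fin by (simp add: p_def poly_prod w prod.remove[of I i] algebra_simps)
      moreover have "poly r w = 2 * x i * residue_coeff I x i * (\<Prod>j\<in>I - {i}. x i - x j)"
      proof -
        have "(\<Prod>j\<in>I - {k}. x i - x j) = 0" if "k \<in> I" "k \<noteq> i" for k
          using that i fin by (intro prod_zero) auto
        then have "(\<Sum>k\<in>I - {i}. 2 * x k * residue_coeff I x k * (\<Prod>j\<in>I - {k}. x i - x j)) = 0"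
          by (intro sum.neutral) simp
        then show ?thesis
          using i fin by (simp add: poly_r w sum.remove[of I i])
      qed
      moreover have "residue_coeff I x i * (\<Prod>j\<in>I - {i}. x i - x j) = (\<Prod>j\<in>I - {i}. x i + x j)"
        using nz by (simp add: residue_coeff_def prod_dividef)
      ultimately show "poly p w = poly (q + r) w" by (simp add: mult.assoc)
    qed
  qed
  then have "poly p z = poly q z + poly r z" by simp
  then show ?thesis
    by (simp add: p_def q_def poly_r poly_prod add.commute)
qed

text \<open>
  The expansion at \<open>z = 0\<close>.
\<close>

lemma sum_residue_coeff:
  fixes x :: "'a \<Rightarrow> 'b::field"
  assumes fin: "finite I" and inj: "inj_on x I" and nz: "\<And>i. i \<in> I \<Longrightarrow> x i \<noteq> 0"
  shows "(\<Sum>i\<in>I. 2 * residue_coeff I x i) = 1 - (-1) ^ card I"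
proof -
  let ?P = "\<Prod>i\<in>I. x i"
  have P: "?P \<noteq> 0" using nz fin by simp
  have neg: "(\<Prod>j\<in>J. - x j) = (-1) ^ card J * prod x J" for J
    by (simp add: prod_uminus)
  have "?P - (-1) ^ card I * ?P = (\<Sum>i\<in>I. 2 * x i * residue_coeff I x i * (\<Prod>j\<in>I - {i}. - x j))"
    using prod_add_minus_prod_diff[OF fin inj, of 0] by (simp add: neg)
  also have "\<dots> = (\<Sum>i\<in>I. 2 * residue_coeff I x i * (- ((-1) ^ card I * ?P)))"
  proof (rule sum.cong[OF refl])
    fix i assume i: "i \<in> I"
    have "x i * (\<Prod>j\<in>I - {i}. - x j) = - (\<Prod>j\<in>I. - x j)"
      using i fin by (simp add: prod.remove[of I i])
    then have "2 * residue_coeff I x i * (x i * (\<Prod>j\<in>I - {i}. - x j)) =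
        2 * residue_coeff I x i * (- ((-1) ^ card I * ?P))"
      unfolding neg by (simp only:)
    then show "2 * x i * residue_coeff I x i * (\<Prod>j\<in>I - {i}. - x j) =
        2 * residue_coeff I x i * (- ((-1) ^ card I * ?P))"
      by (simp only: mult_ac)
  qed
  also have "\<dots> = (\<Sum>i\<in>I. 2 * residue_coeff I x i) * (- ((-1) ^ card I * ?P))"
    by (rule sum_distrib_right[symmetric])
  finally have "(1 - (-1) ^ card I) * ?P = (\<Sum>i\<in>I. 2 * residue_coeff I x i) * (- ((-1) ^ card I)) * ?P"
    by (simp add: algebra_simps)
  then have "1 - (-1) ^ card I = (\<Sum>i\<in>I. 2 * residue_coeff I x i) * (- ((-1) ^ card I))"
    using P mult_right_cancel by blast
  then show ?thesis
    by (cases "even (card I)") auto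
qed

text \<open>
  The expansion at \<open>- z\<close> gives \<open>\<Sum>i. 2 * x i * residue_coeff I x i / (x i + z)\<close>, and
  \<open>(x i - z) / (x i + z) = 2 * x i / (x i + z) - 1\<close>.  The lemma is used twice: for a further point \<open>z\<close>
  with \<open>card I\<close> odd it is Schur's Pfaffian expansion, and for \<open>z\<close> one of the \<open>x i\<close> the product
  vanishes and the sum becomes a constant.
\<close>

lemma sum_residue_coeff_kernel:
  fixes x :: "'a \<Rightarrow> 'b::field"
  assumes fin: "finite I" and inj: "inj_on x I" and nz: "\<And>i. i \<in> I \<Longrightarrow> x i \<noteq> 0"
    and zx: "\<And>i. i \<in> I \<Longrightarrow> z + x i \<noteq> 0"
  shows "(\<Sum>i\<in>I. 2 * residue_coeff I x i * ((x i - z) / (x i + z))) =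
         1 + (-1) ^ card I - 2 * (\<Prod>i\<in>I. (z - x i) / (z + x i))"
proof -
  let ?P = "\<Prod>i\<in>I. z + x i"
  have P: "?P \<noteq> 0" using zx fin by simp
  have neg1: "(\<Prod>i\<in>I. - z + x i) = (-1) ^ card I * (\<Prod>i\<in>I. z - x i)"
    by (subst prod_uminus[symmetric]) simp
  have neg2: "(\<Prod>i\<in>J. - z - x i) = (-1) ^ card J * (\<Prod>i\<in>J. z + x i)" for J
    by (subst prod_uminus[symmetric]) simp
  have "(-1) ^ card I * ((\<Prod>i\<in>I. z - x i) - ?P) =
      (\<Sum>i\<in>I. 2 * x i * residue_coeff I x i * (\<Prod>j\<in>I - {i}. - z - x j))"
    unfolding prod_add_minus_prod_diff[OF fin inj, of "- z", symmetric]
    by (simp only: neg1 neg2 right_diff_distrib)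
  also have "\<dots> = (\<Sum>i\<in>I. 2 * x i * residue_coeff I x i * (- ((-1) ^ card I) * ?P / (z + x i)))"
  proof (rule sum.cong[OF refl])
    fix i assume i: "i \<in> I"
    have "(z + x i) * (\<Prod>j\<in>I - {i}. - z - x j) = - (\<Prod>j\<in>I. - z - x j)"
      using i fin by (simp add: prod.remove[of I i] algebra_simps)
    then have "(\<Prod>j\<in>I - {i}. - z - x j) = - (\<Prod>j\<in>I. - z - x j) / (z + x i)"
      using zx[OF i] by (simp add: field_simps)
    then show "2 * x i * residue_coeff I x i * (\<Prod>j\<in>I - {i}. - z - x j) =
      2 * x i * residue_coeff I x i * (- ((-1) ^ card I) * ?P / (z + x i))"
      by (simp add: neg2)
  qed
  also have "\<dots> = (-1) ^ card I * (- ?P * (\<Sum>i\<in>I. 2 * x i * residue_coeff I x i / (z + x i)))"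
    by (simp add: sum_distrib_left sum_negf mult_ac)
  finally have "(\<Prod>i\<in>I. z - x i) - ?P = - ?P * (\<Sum>i\<in>I. 2 * x i * residue_coeff I x i / (z + x i))"
    by (subst (asm) mult_left_cancel) simp_all
  then have S: "(\<Sum>i\<in>I. 2 * x i * residue_coeff I x i / (z + x i)) = 1 - (\<Prod>i\<in>I. (z - x i) / (z + x i))"
    using P by (simp add: prod_dividef field_simps)
  have "(\<Sum>i\<in>I. 2 * residue_coeff I x i * ((x i - z) / (x i + z))) =
      (\<Sum>i\<in>I. 2 * (2 * x i * residue_coeff I x i / (z + x i)) - 2 * residue_coeff I x i)"
  proof (rule sum.cong[OF refl])
    fix i assume i: "i \<in> I"
    show "2 * residue_coeff I x i * ((x i - z) / (x i + z)) =
      2 * (2 * x i * residue_coeff I x i / (z + x i)) - 2 * residue_coeff I x i"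
      using zx[OF i] by (simp add: field_simps)
  qed
  also have "\<dots> = 2 * (1 - (\<Prod>i\<in>I. (z - x i) / (z + x i))) - (1 - (-1) ^ card I)"
    using sum_residue_coeff[OF fin inj nz] S by (simp only: sum_subtractf flip: sum_distrib_left)
  finally show ?thesis by simp
qed

section \<open>Schur's kernel and its Pfaffian expansion\<close>

definition schur_kernel :: "(nat \<Rightarrow> 'a::field) \<Rightarrow> nat set \<Rightarrow> 'a" where
  "schur_kernel x J = (\<Prod>i\<in>J. \<Prod>j\<in>{j\<in>J. i < j}. (x i - x j) / (x i + x j))"

text \<open>
  The sign of moving \<open>j\<close> to the front of the increasing list of elements of \<open>J\<close>.
\<close>

definition position_sign :: "nat \<Rightarrow> nat set \<Rightarrow> 'a::comm_ring_1" where
  "position_sign j J = (-1) ^ card {i\<in>J. i < j}"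

lemma kernel_flip: "(y - x) / (y + x) = - ((x - y) / (x + y :: 'a::field))"
  by (simp add: add.commute minus_divide_left)

lemma schur_kernel_empty [simp]: "schur_kernel x {} = 1"
  by (simp add: schur_kernel_def)

text \<open>
  Factors \<open>(x i - x j) / (x i + x j)\<close> with \<open>i < j\<close> are reversed, at the cost of one sign each.
\<close>

lemma schur_kernel_extract:
  fixes x :: "nat \<Rightarrow> 'a::field"
  assumes fin: "finite J" and j: "j \<in> J"
  shows "schur_kernel x J = position_sign j (J - {j}) *
    (\<Prod>i\<in>J - {j}. (x j - x i) / (x j + x i)) * schur_kernel x (J - {j})"
proof -
  let ?k = "\<lambda>i l. (x i - x l) / (x i + x l)"
  let ?J = "J - {j}"
  have row: "(\<Prod>l\<in>{l\<in>J. i < l}. ?k i l) = (if i < j then ?k i j else 1) * (\<Prod>l\<in>{l\<in>?J. i < l}. ?k i l)" for i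
  proof (cases "i < j")
    case True
    then have "{l\<in>J. i < l} = insert j {l\<in>?J. i < l}" using j by auto
    then show ?thesis using True fin by simp
  next
    case False
    then have "{l\<in>J. i < l} = {l\<in>?J. i < l}" by auto
    then show ?thesis using False by simp
  qed
  have flip: "(if i < j then ?k i j else 1) * (if j < i then ?k j i else 1) =
       (if i < j then -1 else 1) * ?k j i" if "i \<in> ?J" for i
    using that kernel_flip[of "x i" "x j"] by (auto simp: not_less add.commute)
  have top: "(\<Prod>l\<in>{l\<in>?J. j < l}. ?k j l) = (\<Prod>i\<in>?J. if j < i then ?k j i else 1)"
    using fin by (intro prod.inter_filter) auto
  have sgn: "(\<Prod>i\<in>?J. if i < j then -1 else 1 :: 'a) = position_sign j ?J"
    using fin by (simp add: position_sign_def flip: prod.inter_filter)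
  have "schur_kernel x J = (\<Prod>i\<in>J. (if i < j then ?k i j else 1) * (\<Prod>l\<in>{l\<in>?J. i < l}. ?k i l))"
    unfolding schur_kernel_def row ..
  also have "\<dots> = (\<Prod>i\<in>?J. if j < i then ?k j i else 1) *
      ((\<Prod>i\<in>?J. if i < j then ?k i j else 1) * schur_kernel x ?J)"
    using fin j unfolding top[symmetric] schur_kernel_def
    by (simp add: prod.remove[of J j] prod.distrib)
  also have "\<dots> = (\<Prod>i\<in>?J. (if i < j then ?k i j else 1) * (if j < i then ?k j i else 1)) * schur_kernel x ?J"
    by (simp only: prod.distrib mult_ac)
  also have "\<dots> = (\<Prod>i\<in>?J. (if i < j then -1 else 1) * ?k j i) * schur_kernel x ?J"
    using flip by (metis (no_types, lifting) prod.cong)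
  finally show ?thesis unfolding prod.distrib sgn .
qed

lemma position_sign_remove: "position_sign j (J - {j}) = position_sign j J"
proof -
  have "{i \<in> J - {j}. i < j} = {i \<in> J. i < j}" by auto
  then show ?thesis by (simp add: position_sign_def)
qed

lemma schur_kernel_eq_0:
  assumes "finite J" "a \<in> J" "b \<in> J" "a \<noteq> b" "x a = x b"
  shows "schur_kernel x J = 0"
proof -
  have "(\<Prod>i\<in>J - {a}. (x a - x i) / (x a + x i)) = 0"
    using assms by (intro prod_zero) auto
  then show ?thesis using schur_kernel_extract[OF assms(1,2), of x] by simp
qed

lemma position_sign_swap:
  assumes "finite J" "a \<in> J" "b \<in> J" "a < b"
  shows "position_sign a J * position_sign b (J - {a}) =
       - (position_sign b J * position_sign a (J - {b}) :: 'a::comm_ring_1)"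
proof -
  have "{i \<in> J - {b}. i < a} = {i \<in> J. i < a}" using assms by auto
  moreover have "{i \<in> J. i < b} = insert a {i \<in> J - {a}. i < b}" using assms by auto
  ultimately show ?thesis using assms by (simp add: position_sign_def)
qed

text \<open>
  Schur's Pfaffian identity, as the expansion along the row of an additional point \<open>z\<close>.  When the
  points are distinct, removing \<open>j\<close> multiplies the kernel by the signed residue coefficient at
  \<open>x j\<close>, and the claim is \<open>sum_residue_coeff_kernel\<close>.  The case of coinciding points has to be
  included because the identity is summed over functions that need not be injective: if
  \<open>x a = x b\<close>, then only the summands for \<open>a\<close> and \<open>b\<close> can be nonzero, and these cancel.
\<close>

lemma schur_kernel_expansion:
  fixes x :: "nat \<Rightarrow> 'a::field"
  assumes fin: "finite J" and odd: "odd (card J)"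
    and nz: "\<And>i j. i \<in> J \<Longrightarrow> j \<in> J \<Longrightarrow> x i + x j \<noteq> 0"
    and z: "\<And>i. i \<in> J \<Longrightarrow> z + x i \<noteq> 0"
  shows "(\<Prod>i\<in>J. (z - x i) / (z + x i)) * schur_kernel x J =
    (\<Sum>j\<in>J. position_sign j J * ((z - x j) / (z + x j)) * schur_kernel x (J - {j}))"
proof (cases "inj_on x J")
  case inj: True
  have x0: "x i \<noteq> 0" if "i \<in> J" for i
    using nz[OF that that] by auto
  obtain i0 where "i0 \<in> J" using odd by (metis card.empty even_zero ex_in_conv)
  then have two: "(2::'a) \<noteq> 0" using nz[of i0 i0] by (metis mult_2 mult_zero_left)
  have removed: "position_sign j J * schur_kernel x (J - {j}) = residue_coeff J x j * schur_kernel x J"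
    if j: "j \<in> J" for j
  proof -
    have "(\<Prod>i\<in>J - {j}. (x j + x i) / (x j - x i)) * (\<Prod>i\<in>J - {j}. (x j - x i) / (x j + x i)) = 1"
      unfolding prod.distrib[symmetric]
      using inj j nz by (intro prod.neutral) (auto simp: inj_on_def)
    then have "residue_coeff J x j * schur_kernel x J = position_sign j J * schur_kernel x (J - {j})"
      unfolding schur_kernel_extract[OF fin j] position_sign_remove residue_coeff_def
      by (simp add: mult_ac)
    then show ?thesis ..
  qed
  have "(\<Sum>i\<in>J. 2 * residue_coeff J x i * ((x i - z) / (x i + z))) = - 2 * (\<Prod>i\<in>J. (z - x i) / (z + x i))"
    using sum_residue_coeff_kernel[OF fin inj x0 z] odd by simp
  then have "2 * (\<Sum>i\<in>J. residue_coeff J x i * ((z - x i) / (z + x i))) = 2 * (\<Prod>i\<in>J. (z - x i) / (z + x i))"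
    unfolding kernel_flip[of _ z] by (simp add: sum_negf sum_distrib_left mult.assoc)
  then have *: "(\<Prod>i\<in>J. (z - x i) / (z + x i)) = (\<Sum>i\<in>J. residue_coeff J x i * ((z - x i) / (z + x i)))"
    using two by simp
  show ?thesis
    unfolding * sum_distrib_right
  proof (rule sum.cong[OF refl])
    fix j assume "j \<in> J"
    have "residue_coeff J x j * ((z - x j) / (z + x j)) * schur_kernel x J =
      (residue_coeff J x j * schur_kernel x J) * ((z - x j) / (z + x j))"
      by (simp only: mult_ac)
    then show "residue_coeff J x j * ((z - x j) / (z + x j)) * schur_kernel x J =
      position_sign j J * ((z - x j) / (z + x j)) * schur_kernel x (J - {j})"
      unfolding removed[OF \<open>j \<in> J\<close>, symmetric] by (simp only: mult_ac)
  qed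
next
  case False
  have "\<exists>a\<in>J. \<exists>b\<in>J. a < b \<and> x a = x b"
  proof (rule ccontr)
    assume "\<not> ?thesis"
    then have "inj_on x J" by (intro linorder_inj_onI') auto
    with False show False ..
  qed
  then obtain a b where ab: "a \<in> J" "b \<in> J" "a < b" "x a = x b" by blast
  let ?t = "\<lambda>j. position_sign j J * ((z - x j) / (z + x j)) * schur_kernel x (J - {j})"
  have "?t j = 0" if "j \<in> J - {a, b}" for j
    using schur_kernel_eq_0[of "J - {j}" a b x] that ab fin by auto
  then have "(\<Sum>j\<in>J. ?t j) = (\<Sum>j\<in>{a, b}. ?t j)"
    using ab fin by (intro sum.mono_neutral_right) auto
  also have "\<dots> = ?t a + ?t b" using ab by simp
  also have "\<dots> = 0"
  proof -
    have sets: "J - {b} - {a} = J - {a} - {b}" by auto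
    \<comment> \<open>Both kernels reduce to that of \<open>J - {a, b}\<close> with the same product, since \<open>x a = x b\<close>.\<close>
    have "schur_kernel x (J - {a}) = position_sign b (J - {a}) *
       (\<Prod>i\<in>J - {a} - {b}. (x b - x i) / (x b + x i)) * schur_kernel x (J - {a} - {b})"
      using schur_kernel_extract[of "J - {a}" b x] ab fin unfolding position_sign_remove by simp
    moreover have "schur_kernel x (J - {b}) = position_sign a (J - {b}) *
       (\<Prod>i\<in>J - {a} - {b}. (x b - x i) / (x b + x i)) * schur_kernel x (J - {a} - {b})"
      using schur_kernel_extract[of "J - {b}" a x] ab fin unfolding position_sign_remove unfolding sets by simp
    ultimately have "?t a + ?t b =
       (position_sign a J * position_sign b (J - {a}) + position_sign b J * position_sign a (J - {b})) *
       ((z - x b) / (z + x b) * (\<Prod>i\<in>J - {a} - {b}. (x b - x i) / (x b + x i)) * schur_kernel x (J - {a} - {b}))"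
      by (simp only: ab(4) distrib_right) (simp only: mult_ac)
    then show ?thesis
      unfolding position_sign_swap[OF fin ab(1-3)] by simp
  qed
  finally show ?thesis using schur_kernel_eq_0[OF fin ab(1,2) _ ab(4)] ab(3) by simp
qed

text \<open>
  For even \<open>card J\<close> this is the Pfaffian of the antisymmetric matrix whose entries above the diagonal
  are \<open>\<beta> i j\<close>, expanded along its first row; for odd \<open>card J\<close> the matrix is bordered by a first row
  with entries \<open>\<gamma> j\<close>.  Expansion along a row, rather than a sum over matchings, is what the kernel sums
  satisfy directly.  The value for infinite \<open>J\<close> is a dummy.
\<close>

function pfaffian :: "(nat \<Rightarrow> nat \<Rightarrow> 'a::comm_ring_1) \<Rightarrow> (nat \<Rightarrow> 'a) \<Rightarrow> nat set \<Rightarrow> 'a" where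
  "pfaffian \<beta> \<gamma> J =
    (if infinite J \<or> J = {} then 1
     else if odd (card J) then \<Sum>j\<in>J. position_sign j J * \<gamma> j * pfaffian \<beta> \<gamma> (J - {j})
     else \<Sum>j\<in>J - {Min J}. position_sign j (J - {Min J}) * \<beta> (Min J) j * pfaffian \<beta> \<gamma> (J - {Min J} - {j}))"
  by auto
termination
  by (relation "measure (\<lambda>(_, _, J). card J)")
     (auto intro!: psubset_card_mono simp del: card_Diff_insert card_Diff_singleton)

declare pfaffian.simps [simp del]

lemma pfaffian_infinite: "infinite J \<Longrightarrow> pfaffian \<beta> \<gamma> J = 1"
  by (simp add: pfaffian.simps)

lemma pfaffian_empty: "pfaffian \<beta> \<gamma> {} = 1"
  by (simp add: pfaffian.simps)

lemma pfaffian_odd: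
  "finite J \<Longrightarrow> odd (card J) \<Longrightarrow>
   pfaffian \<beta> \<gamma> J = (\<Sum>j\<in>J. position_sign j J * \<gamma> j * pfaffian \<beta> \<gamma> (J - {j}))"
  by (subst pfaffian.simps) auto

lemma pfaffian_even:
  "finite J \<Longrightarrow> J \<noteq> {} \<Longrightarrow> even (card J) \<Longrightarrow> pfaffian \<beta> \<gamma> J =
   (\<Sum>j\<in>J - {Min J}. position_sign j (J - {Min J}) * \<beta> (Min J) j * pfaffian \<beta> \<gamma> (J - {Min J} - {j}))"
  by (subst pfaffian.simps) auto

lemma schur_kernel_cong:
  "(\<And>i. i \<in> J \<Longrightarrow> x i = y i) \<Longrightarrow> schur_kernel x J = schur_kernel y J"
  unfolding schur_kernel_def by (intro prod.cong) auto

definition kernel_sum :: "'k set \<Rightarrow> ('k \<Rightarrow> 'a::field) \<Rightarrow> (nat \<Rightarrow> 'k \<Rightarrow> 'a) \<Rightarrow> nat set \<Rightarrow> 'a" where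
  "kernel_sum I y u J =
     (\<Sum>k\<in>J \<rightarrow>\<^sub>E I. (\<Prod>i\<in>J. u i (k i)) * schur_kernel (\<lambda>i. y (k i)) J)"

lemma sum_PiE_insert:
  assumes "j \<notin> S"
  shows "(\<Sum>k\<in>insert j S \<rightarrow>\<^sub>E I. f k) = (\<Sum>p\<in>I. \<Sum>k\<in>S \<rightarrow>\<^sub>E I. f (k(j := p)))"
proof -
  have "(\<Sum>k\<in>insert j S \<rightarrow>\<^sub>E I. f k) = (\<Sum>(p, k)\<in>I \<times> (S \<rightarrow>\<^sub>E I). f (k(j := p)))"
    unfolding PiE_insert_eq using inj_combinator[OF assms, of "\<lambda>_. I"]
    by (subst sum.reindex) (auto simp: o_def case_prod_unfold)
  then show ?thesis by (simp add: sum.cartesian_product)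
qed

text \<open>
  For an odd number of points the additional point in \<open>schur_kernel_expansion\<close> is \<open>0\<close>, so that every
  factor \<open>(0 - y) / (0 + y)\<close> is \<open>-1\<close>.  The summand belonging to \<open>j\<close> involves \<open>k j\<close> only through
  \<open>u j (k j)\<close>, and the sum over \<open>k j\<close> splits off.
\<close>

lemma kernel_sum_odd:
  fixes y :: "'k \<Rightarrow> 'a::field"
  assumes J: "finite J" "odd (card J)"
    and nz: "\<forall>p\<in>I. \<forall>q\<in>I. y p + y q \<noteq> 0"
  shows "kernel_sum I y u J = (\<Sum>j\<in>J. position_sign j J * (\<Sum>p\<in>I. u j p) * kernel_sum I y u (J - {j}))"
proof -
  have one: "schur_kernel (\<lambda>i. y (k i)) J = (\<Sum>j\<in>J. position_sign j J * schur_kernel (\<lambda>i. y (k i)) (J - {j}))"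
    if k: "k \<in> J \<rightarrow>\<^sub>E I" for k
  proof -
    have kI: "k i \<in> I" if "i \<in> J" for i using k that by auto
    have y0: "y (k i) \<noteq> 0" if "i \<in> J" for i using nz kI[OF that] by fastforce
    have "(\<Prod>i\<in>J. (0 - y (k i)) / (0 + y (k i))) = (\<Prod>i\<in>J. -1)"
      by (rule prod.cong) (use y0 in auto)
    also have "\<dots> = -1" using J by simp
    finally have "- schur_kernel (\<lambda>i. y (k i)) J =
       (\<Sum>j\<in>J. position_sign j J * ((0 - y (k j)) / (0 + y (k j))) * schur_kernel (\<lambda>i. y (k i)) (J - {j}))"
      using schur_kernel_expansion[OF J, of "\<lambda>i. y (k i)" 0] nz kI y0 by simp
    also have "\<dots> = (\<Sum>j\<in>J. - (position_sign j J * schur_kernel (\<lambda>i. y (k i)) (J - {j})))"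
      by (rule sum.cong) (use y0 in auto)
    finally show ?thesis by (simp add: sum_negf)
  qed
  have split: "(\<Sum>k\<in>J \<rightarrow>\<^sub>E I. (\<Prod>i\<in>J. u i (k i)) * schur_kernel (\<lambda>i. y (k i)) (J - {j})) =
      (\<Sum>p\<in>I. u j p) * kernel_sum I y u (J - {j})" if j: "j \<in> J" for j
  proof -
    have "(\<Sum>k\<in>J \<rightarrow>\<^sub>E I. (\<Prod>i\<in>J. u i (k i)) * schur_kernel (\<lambda>i. y (k i)) (J - {j})) =
      (\<Sum>p\<in>I. \<Sum>k\<in>(J - {j}) \<rightarrow>\<^sub>E I. (\<Prod>i\<in>J. u i ((k(j := p)) i)) *
         schur_kernel (\<lambda>i. y ((k(j := p)) i)) (J - {j}))"
      using sum_PiE_insert[of j "J - {j}" "\<lambda>k. (\<Prod>i\<in>J. u i (k i)) * schur_kernel (\<lambda>i. y (k i)) (J - {j})" I]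
      by (simp only: insert_Diff[OF j] Diff_iff singleton_iff simp_thms)
    also have "\<dots> = (\<Sum>p\<in>I. \<Sum>k\<in>(J - {j}) \<rightarrow>\<^sub>E I. u j p *
        ((\<Prod>i\<in>J - {j}. u i (k i)) * schur_kernel (\<lambda>i. y (k i)) (J - {j})))"
    proof (intro sum.cong refl)
      fix p k
      have "(\<Prod>i\<in>J. u i ((k(j := p)) i)) = u j p * (\<Prod>i\<in>J - {j}. u i (k i))"
        using j J by (simp add: prod.remove[of J j])
      moreover have "schur_kernel (\<lambda>i. y ((k(j := p)) i)) (J - {j}) = schur_kernel (\<lambda>i. y (k i)) (J - {j})"
        by (rule schur_kernel_cong) simp
      ultimately show "(\<Prod>i\<in>J. u i ((k(j := p)) i)) * schur_kernel (\<lambda>i. y ((k(j := p)) i)) (J - {j}) =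
         u j p * ((\<Prod>i\<in>J - {j}. u i (k i)) * schur_kernel (\<lambda>i. y (k i)) (J - {j}))"
        by (simp only: mult.assoc)
    qed
    finally show ?thesis
      unfolding kernel_sum_def sum_product by simp
  qed
  have "kernel_sum I y u J = (\<Sum>k\<in>J \<rightarrow>\<^sub>E I. \<Sum>j\<in>J. position_sign j J *
      ((\<Prod>i\<in>J. u i (k i)) * schur_kernel (\<lambda>i. y (k i)) (J - {j})))"
    unfolding kernel_sum_def
  proof (intro sum.cong refl)
    fix k assume "k \<in> J \<rightarrow>\<^sub>E I"
    then show "(\<Prod>i\<in>J. u i (k i)) * schur_kernel (\<lambda>i. y (k i)) J =
      (\<Sum>j\<in>J. position_sign j J * ((\<Prod>i\<in>J. u i (k i)) * schur_kernel (\<lambda>i. y (k i)) (J - {j})))"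
      by (simp only: one) (simp add: sum_distrib_left mult.left_commute)
  qed
  also have "\<dots> = (\<Sum>j\<in>J. position_sign j J *
      (\<Sum>k\<in>J \<rightarrow>\<^sub>E I. (\<Prod>i\<in>J. u i (k i)) * schur_kernel (\<lambda>i. y (k i)) (J - {j})))"
    by (subst sum.swap) (simp add: sum_distrib_left)
  also have "\<dots> = (\<Sum>j\<in>J. position_sign j J * (\<Sum>p\<in>I. u j p) * kernel_sum I y u (J - {j}))"
    by (intro sum.cong refl) (simp only: split mult.assoc)
  finally show ?thesis .
qed

text \<open>
  For an even number of points the one with the smallest index serves as the additional point.
\<close>

lemma kernel_sum_even:
  fixes y :: "'k \<Rightarrow> 'a::field"
  assumes J: "finite J" "even (card J)" "J \<noteq> {}"
    and nz: "\<forall>p\<in>I. \<forall>q\<in>I. y p + y q \<noteq> 0"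
  defines "m \<equiv> Min J" and "J' \<equiv> J - {Min J}"
  shows "kernel_sum I y u J = (\<Sum>j\<in>J'. position_sign j J' *
     (\<Sum>p\<in>I. \<Sum>q\<in>I. u m p * u j q * ((y p - y q) / (y p + y q))) * kernel_sum I y u (J' - {j}))"
proof -
  have m: "m \<in> J" using J by (simp add: m_def)
  have Jm: "J = insert m J'" "m \<notin> J'" using m by (auto simp: J'_def m_def)
  have fin: "finite J'" using J by (simp add: J'_def)
  have oddJ': "odd (card J')" using J Jm fin by simp
  have sgn: "position_sign m J' = (1 :: 'a)"
  proof -
    have "{i \<in> J'. i < m} = {}" using J by (auto simp: J'_def m_def not_less)
    then have "card {i \<in> J'. i < m} = 0" by (simp only: card.empty)
    then show ?thesis by (simp only: position_sign_def power_0)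
  qed
  have one: "schur_kernel (\<lambda>i. y (k i)) J =
      (\<Sum>j\<in>J'. position_sign j J' * ((y (k m) - y (k j)) / (y (k m) + y (k j))) * schur_kernel (\<lambda>i. y (k i)) (J' - {j}))"
    if k: "k \<in> J \<rightarrow>\<^sub>E I" for k
  proof -
    have kI: "k i \<in> I" if "i \<in> J" for i using k that by auto
    have "schur_kernel (\<lambda>i. y (k i)) J =
       (\<Prod>i\<in>J'. (y (k m) - y (k i)) / (y (k m) + y (k i))) * schur_kernel (\<lambda>i. y (k i)) J'"
      using schur_kernel_extract[OF J(1) m, of "\<lambda>i. y (k i)"] sgn by (simp add: J'_def m_def)
    also have "\<dots> = (\<Sum>j\<in>J'. position_sign j J' * ((y (k m) - y (k j)) / (y (k m) + y (k j)))
       * schur_kernel (\<lambda>i. y (k i)) (J' - {j}))"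
      using Jm nz kI by (intro schur_kernel_expansion[OF fin oddJ']) auto
    finally show ?thesis .
  qed
  have split: "(\<Sum>k\<in>J \<rightarrow>\<^sub>E I. (\<Prod>i\<in>J. u i (k i)) * ((y (k m) - y (k j)) / (y (k m) + y (k j))) *
        schur_kernel (\<lambda>i. y (k i)) (J' - {j})) =
      (\<Sum>p\<in>I. \<Sum>q\<in>I. u m p * u j q * ((y p - y q) / (y p + y q))) * kernel_sum I y u (J' - {j})"
    if j: "j \<in> J'" for j
  proof -
    let ?S = "J' - {j}"
    have S: "J' = insert j ?S" "j \<notin> ?S" using j by auto
    have mS: "m \<notin> ?S" "j \<noteq> m" "m \<notin> insert j ?S" using Jm j by auto
    have set: "J \<rightarrow>\<^sub>E I = insert m (insert j ?S) \<rightarrow>\<^sub>E I" using Jm S by simp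
    have "(\<Sum>k\<in>J \<rightarrow>\<^sub>E I. (\<Prod>i\<in>J. u i (k i)) * ((y (k m) - y (k j)) / (y (k m) + y (k j))) *
        schur_kernel (\<lambda>i. y (k i)) ?S) =
      (\<Sum>p\<in>I. \<Sum>q\<in>I. \<Sum>k\<in>?S \<rightarrow>\<^sub>E I. (\<Prod>i\<in>J. u i ((k(j := q, m := p)) i)) * ((y p - y q) / (y p + y q)) *
         schur_kernel (\<lambda>i. y ((k(j := q, m := p)) i)) ?S)"
      by (simp only: set sum_PiE_insert[OF mS(3)] sum_PiE_insert[OF S(2)] fun_upd_apply mS if_True if_False refl)
    also have "\<dots> = (\<Sum>p\<in>I. \<Sum>q\<in>I. \<Sum>k\<in>?S \<rightarrow>\<^sub>E I. u m p * u j q * ((y p - y q) / (y p + y q)) *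
        ((\<Prod>i\<in>?S. u i (k i)) * schur_kernel (\<lambda>i. y (k i)) ?S))"
    proof (intro sum.cong refl)
      fix p q k
      have "prod f J = f m * (f j * prod f ?S)" for f :: "nat \<Rightarrow> 'a"
        unfolding prod.remove[OF fin j, symmetric] using prod.remove[OF J(1) m, of f]
        by (simp only: J'_def m_def)
      from this[of "\<lambda>i. u i ((k(j := q, m := p)) i)"]
      have "(\<Prod>i\<in>J. u i ((k(j := q, m := p)) i)) = u m p * (u j q * (\<Prod>i\<in>?S. u i ((k(j := q, m := p)) i)))"
        using mS(2) by simp
      also have "(\<Prod>i\<in>?S. u i ((k(j := q, m := p)) i)) = (\<Prod>i\<in>?S. u i (k i))"
        using mS by (intro prod.cong) auto
      finally have "(\<Prod>i\<in>J. u i ((k(j := q, m := p)) i)) = u m p * (u j q * (\<Prod>i\<in>?S. u i (k i)))" .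
      moreover have "schur_kernel (\<lambda>i. y ((k(j := q, m := p)) i)) ?S = schur_kernel (\<lambda>i. y (k i)) ?S"
        using mS by (intro schur_kernel_cong) auto
      ultimately show "(\<Prod>i\<in>J. u i ((k(j := q, m := p)) i)) * ((y p - y q) / (y p + y q)) *
         schur_kernel (\<lambda>i. y ((k(j := q, m := p)) i)) ?S =
         u m p * u j q * ((y p - y q) / (y p + y q)) *
        ((\<Prod>i\<in>?S. u i (k i)) * schur_kernel (\<lambda>i. y (k i)) ?S)"
        by (simp only: mult_ac)
    qed
    finally show ?thesis
      unfolding kernel_sum_def by (simp only: sum_distrib_right) (simp only: sum_distrib_left)
  qed
  have "kernel_sum I y u J = (\<Sum>k\<in>J \<rightarrow>\<^sub>E I. \<Sum>j\<in>J'. position_sign j J' *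
      ((\<Prod>i\<in>J. u i (k i)) * ((y (k m) - y (k j)) / (y (k m) + y (k j))) * schur_kernel (\<lambda>i. y (k i)) (J' - {j})))"
    unfolding kernel_sum_def
  proof (intro sum.cong refl)
    fix k assume "k \<in> J \<rightarrow>\<^sub>E I"
    then show "(\<Prod>i\<in>J. u i (k i)) * schur_kernel (\<lambda>i. y (k i)) J =
      (\<Sum>j\<in>J'. position_sign j J' *
      ((\<Prod>i\<in>J. u i (k i)) * ((y (k m) - y (k j)) / (y (k m) + y (k j))) * schur_kernel (\<lambda>i. y (k i)) (J' - {j})))"
      by (simp only: one) (simp only: sum_distrib_left mult_ac)
  qed
  also have "\<dots> = (\<Sum>j\<in>J'. position_sign j J' *
      (\<Sum>k\<in>J \<rightarrow>\<^sub>E I. (\<Prod>i\<in>J. u i (k i)) * ((y (k m) - y (k j)) / (y (k m) + y (k j))) * schur_kernel (\<lambda>i. y (k i)) (J' - {j})))"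
    by (subst sum.swap) (simp only: sum_distrib_left)
  also have "\<dots> = (\<Sum>j\<in>J'. position_sign j J' *
     (\<Sum>p\<in>I. \<Sum>q\<in>I. u m p * u j q * ((y p - y q) / (y p + y q))) * kernel_sum I y u (J' - {j}))"
    by (intro sum.cong refl) (simp only: split, simp only: mult.assoc)
  finally show ?thesis .
qed

text \<open>
  A kernel sum with any number of variables is determined by its values for one and two variables.
\<close>

theorem kernel_sum_eq_pfaffian:
  fixes y :: "'k \<Rightarrow> 'a::field"
  assumes "finite J"
    and nz: "\<forall>p\<in>I. \<forall>q\<in>I. y p + y q \<noteq> 0"
    and "\<And>j. j \<in> J \<Longrightarrow> \<gamma> j = (\<Sum>p\<in>I. u j p)"
    and "\<And>i j. i \<in> J \<Longrightarrow> j \<in> J \<Longrightarrow>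
           \<beta> i j = (\<Sum>p\<in>I. \<Sum>q\<in>I. u i p * u j q * ((y p - y q) / (y p + y q)))"
  shows "pfaffian \<beta> \<gamma> J = kernel_sum I y u J"
  using assms(1,3,4)
proof (induction "card J" arbitrary: J rule: less_induct)
  case less
  note IH = less.hyps and fin = \<open>finite J\<close> and \<gamma> = less.prems(2) and \<beta> = less.prems(3)
  consider "J = {}" | "odd (card J)" | "even (card J)" "J \<noteq> {}" by blast
  then show ?case
  proof cases
    case 1
    then show ?thesis by (simp add: pfaffian_empty kernel_sum_def)
  next
    case 2
    have "pfaffian \<beta> \<gamma> (J - {j}) = kernel_sum I y u (J - {j})" if "j \<in> J" for j
      by (rule IH[OF card_Diff1_less]) (use that fin \<gamma> \<beta> in auto)
    then show ?thesis
      unfolding kernel_sum_odd[of J I y u, OF fin 2 nz] pfaffian_odd[OF fin 2]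
      using \<gamma> by (intro sum.cong) simp_all
  next
    case 3
    let ?J = "J - {Min J}"
    have "Min J \<in> J" using 3 fin by simp
    then have "pfaffian \<beta> \<gamma> (?J - {j}) = kernel_sum I y u (?J - {j})" if "j \<in> ?J" for j
      by (intro IH psubset_card_mono) (use that fin \<gamma> \<beta> in auto)
    then show ?thesis
      unfolding kernel_sum_even[of J I y u, OF fin 3 nz] pfaffian_even[OF fin 3(2,1)]
      using \<beta> \<open>Min J \<in> J\<close> by (intro sum.cong) simp_all
  qed
qed

text \<open>
  Two homomorphisms are needed: the embedding of polynomials into rational functions, which
  identifies \<open>Q\<^sub>\<lambda>\<close>, and the evaluation at a point.
\<close>

locale unital_ring_hom =
  fixes h :: "'a::comm_ring_1 \<Rightarrow> 'b::comm_ring_1"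
  assumes add: "h (x + y) = h x + h y" and mult: "h (x * y) = h x * h y" and one: "h 1 = 1"
begin

lemma zero: "h 0 = 0"
  using add[of 0 0] by simp

lemma uminus: "h (- x) = - h x"
  using add[of x "- x"] by (simp add: zero eq_neg_iff_add_eq_0 add.commute)

lemma diff: "h (x - y) = h x - h y"
  using add[of x "- y"] by (simp add: uminus)

lemma power: "h (x ^ n) = h x ^ n"
  by (induction n) (simp_all add: one mult)

lemma sum: "h (sum f A) = (\<Sum>a\<in>A. h (f a))"
  by (induction A rule: infinite_finite_induct) (simp_all add: zero add)

lemma position_sign: "h (position_sign j A) = position_sign j A"
  by (simp add: position_sign_def power uminus one)

lemma pfaffian: "h (pfaffian \<beta> \<gamma> J) = pfaffian (\<lambda>i j. h (\<beta> i j)) (\<lambda>i. h (\<gamma> i)) J"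
proof (cases "finite J")
  case False
  then show ?thesis using one by (simp add: pfaffian_infinite)
next
  case True
  then show ?thesis
  proof (induction "card J" arbitrary: J rule: less_induct)
    case less
    note IH = less.hyps and fin = \<open>finite J\<close>
    consider "J = {}" | "odd (card J)" | "even (card J)" "J \<noteq> {}" by blast
    then show ?case
    proof cases
      case 1
      then show ?thesis by (simp add: pfaffian_empty one)
    next
      case 2
      have "h (pfaffian \<beta> \<gamma> (J - {j})) = pfaffian (\<lambda>i j. h (\<beta> i j)) (\<lambda>i. h (\<gamma> i)) (J - {j})" if "j \<in> J" for j
        by (rule IH[OF card_Diff1_less]) (use that fin in auto)
      then show ?thesis
        unfolding pfaffian_odd[OF fin 2] by (simp add: sum mult position_sign)
    next
      case 3
      let ?J = "J - {Min J}"
      have "Min J \<in> J" using 3 fin by simp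
      then have "h (pfaffian \<beta> \<gamma> (?J - {j})) = pfaffian (\<lambda>i j. h (\<beta> i j)) (\<lambda>i. h (\<gamma> i)) (?J - {j})"
        if "j \<in> ?J" for j
        by (intro IH psubset_card_mono) (use that fin in auto)
      then show ?thesis
        unfolding pfaffian_even[OF fin 3(2,1)] by (simp add: sum mult position_sign)
    qed
  qed
qed

end

section \<open>Evaluation of multivariate polynomials\<close>

text \<open>
  Evaluation is multiplicative because it is so on monomials and polynomials are sums of monomials.
  The supports of sums and products may shrink by cancellation, so sums over supports are first
  extended to larger finite sets.
\<close>

definition monomial_value :: "(nat \<Rightarrow> real) \<Rightarrow> (nat \<Rightarrow>\<^sub>0 nat) \<Rightarrow> real" where
  "monomial_value x e = (\<Prod>i\<in>Poly_Mapping.keys e. x i ^ Poly_Mapping.lookup e i)"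

lemma monomial_value_superset:
  "finite S \<Longrightarrow> Poly_Mapping.keys e \<subseteq> S \<Longrightarrow> monomial_value x e = (\<Prod>i\<in>S. x i ^ Poly_Mapping.lookup e i)"
  unfolding monomial_value_def by (intro prod.mono_neutral_left) (auto simp: in_keys_iff)

lemma monomial_value_add: "monomial_value x (e + f) = monomial_value x e * monomial_value x f"
proof -
  let ?S = "Poly_Mapping.keys e \<union> Poly_Mapping.keys f"
  have "monomial_value x (e + f) = (\<Prod>i\<in>?S. x i ^ Poly_Mapping.lookup (e + f) i)"
    using keys_add[of e f] by (intro monomial_value_superset) auto
  also have "\<dots> = monomial_value x e * monomial_value x f"
    by (simp add: monomial_value_superset[of ?S] lookup_add power_add prod.distrib)
  finally show ?thesis .
qed

lemma mveval_superset:
  "finite S \<Longrightarrow> Poly_Mapping.keys P \<subseteq> S \<Longrightarrow>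
   mveval P x = (\<Sum>e\<in>S. Poly_Mapping.lookup P e * monomial_value x e)"
  unfolding mveval_def monomial_value_def[symmetric]
  by (intro sum.mono_neutral_left) (auto simp: in_keys_iff)

lemma mveval_add: "mveval (P + Q) x = mveval P x + mveval Q x"
proof -
  let ?S = "Poly_Mapping.keys P \<union> Poly_Mapping.keys Q"
  have "mveval (P + Q) x = (\<Sum>e\<in>?S. Poly_Mapping.lookup (P + Q) e * monomial_value x e)"
    using keys_add[of P Q] by (intro mveval_superset) auto
  also have "\<dots> = mveval P x + mveval Q x"
    by (simp add: mveval_superset[of ?S] lookup_add distrib_right sum.distrib)
  finally show ?thesis .
qed

lemma mveval_single: "mveval (Poly_Mapping.single e c) x = c * monomial_value x e"
  by (subst mveval_superset[of "{e}"]) (auto simp: lookup_single)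

lemma mveval_sum: "mveval (sum f A) x = (\<Sum>a\<in>A. mveval (f a) x)"
proof -
  have "mveval 0 x = 0" by (simp add: mveval_def)
  then show ?thesis
    by (induction A rule: infinite_finite_induct) (auto simp: mveval_add)
qed

lemma poly_mapping_eq_sum_single:
  "P = (\<Sum>e\<in>Poly_Mapping.keys P. Poly_Mapping.single e (Poly_Mapping.lookup P e))"
  by (rule poly_mapping_eqI) (simp add: lookup_sum lookup_single when_def in_keys_iff)

lemma mveval_mult: "mveval (P * Q) x = mveval P x * mveval Q x"
proof -
  let ?t = "\<lambda>P e. Poly_Mapping.single e (Poly_Mapping.lookup P e) :: mvpoly"
  have "P * Q = sum (?t P) (Poly_Mapping.keys P) * sum (?t Q) (Poly_Mapping.keys Q)"
    by (rule arg_cong2[where f = "(*)", OF poly_mapping_eq_sum_single poly_mapping_eq_sum_single])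
  also have "\<dots> = (\<Sum>e\<in>Poly_Mapping.keys P. \<Sum>f\<in>Poly_Mapping.keys Q. ?t P e * ?t Q f)"
    by (rule sum_product)
  finally have "mveval (P * Q) x = (\<Sum>e\<in>Poly_Mapping.keys P. \<Sum>f\<in>Poly_Mapping.keys Q.
      Poly_Mapping.lookup P e * monomial_value x e * (Poly_Mapping.lookup Q f * monomial_value x f))"
    by (simp add: mveval_sum mult_single mveval_single monomial_value_add mult_ac)
  also have "\<dots> = mveval P x * mveval Q x"
    by (simp add: mveval_def sum_product flip: monomial_value_def)
  finally show ?thesis .
qed

interpretation mveval: unital_ring_hom "\<lambda>P. mveval P x"
proof
  show "mveval 1 x = 1"
    unfolding single_one[symmetric] mveval_single by (simp add: monomial_value_def)
qed (simp_all add: mveval_add mveval_mult)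

interpretation to_ratfun: unital_ring_hom to_ratfun
  by standard (simp_all add: to_ratfun_def One_fract_def)

lemma mveval_mvar: "mveval (mvar i) x = x i"
  by (simp add: mvar_def mveval_single monomial_value_def)

text \<open>
  The case \<open>i = j\<close> is included: it says that variables are nonzero and that \<open>2 \<noteq> 0\<close>.
\<close>

lemma mvar_add_neq_0: "mvar i + mvar j \<noteq> 0"
proof
  assume "mvar i + mvar j = 0"
  then have "mveval (mvar i + mvar j) (\<lambda>_. 1) = 0" by (simp add: mveval.zero)
  then show False by (simp add: mveval_add mveval_mvar)
qed

lemma inj_mvar: "inj mvar"
proof (rule injI)
  fix i j assume "mvar i = mvar j"
  then have "mveval (mvar i) real = mveval (mvar j) real" by simp
  then show "i = j" by (simp add: mveval_mvar)
qed

section \<open>Q-polynomials as Pfaffians\<close>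

text \<open>
  For \<open>l > 0\<close> this is the coefficient of \<open>z\<^sup>l\<close> in \<open>\<Prod>i<N. (1 + x i * z) / (1 - x i * z)\<close>, the
  Q-polynomial of the partition \<open>(l)\<close>.  The value at \<open>l = 0\<close> differs from the constant coefficient
  \<open>1\<close>: it is the one for which \<open>sum_power_eq_q_coeff\<close> holds for all \<open>l\<close>.
\<close>

fun q_coeff :: "(nat \<Rightarrow> 'a::comm_ring_1) \<Rightarrow> nat \<Rightarrow> nat \<Rightarrow> 'a" where
  "q_coeff x N 0 = 1 - (-1) ^ N"
| "q_coeff x 0 (Suc l) = 0"
| "q_coeff x (Suc N) (Suc l) = x N * q_coeff x (Suc N) l + q_coeff x N (Suc l) + x N * q_coeff x N l"

text \<open>
  The Q-polynomial of \<open>(a, b)\<close> for \<open>a, b > 0\<close>, with the values at \<open>b = 0\<close> chosen for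
  \<open>sum_pair_eq_q_pair\<close>.
\<close>

fun q_pair :: "(nat \<Rightarrow> 'a::comm_ring_1) \<Rightarrow> nat \<Rightarrow> nat \<Rightarrow> nat \<Rightarrow> 'a" where
  "q_pair x N a 0 = (1 + (-1) ^ N) * q_coeff x N a"
| "q_pair x N a (Suc b) =
     q_coeff x N a * q_coeff x N (Suc b) - q_coeff x N (Suc a) * q_coeff x N b - q_pair x N (Suc a) b"

lemma (in unital_ring_hom) q_coeff: "h (q_coeff x N l) = q_coeff (\<lambda>i. h (x i)) N l"
  by (induction x N l rule: q_coeff.induct) (simp_all add: add mult diff one uminus power zero)

lemma (in unital_ring_hom) q_pair: "h (q_pair x N a b) = q_pair (\<lambda>i. h (x i)) N a b"
  by (induction b arbitrary: a) (simp_all add: add mult diff one uminus power q_coeff)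

text \<open>
  Multiplying the residue coefficient at \<open>x i\<close> for \<open>Suc N\<close> variables by \<open>x i - x N\<close> gives the one for
  \<open>N\<close> variables times \<open>x i + x N\<close>, and the term of the last variable drops out.  This is the recursion
  of \<open>q_coeff\<close>; the initial values are \<open>sum_residue_coeff\<close>.
\<close>

lemma sum_power_eq_q_coeff:
  fixes x :: "nat \<Rightarrow> 'a::field"
  assumes "inj_on x {..<N}" and "\<forall>i<N. x i \<noteq> 0"
  shows "(\<Sum>i<N. 2 * residue_coeff {..<N} x i * x i ^ l) = q_coeff x N l"
  using assms
proof (induction x N l rule: q_coeff.induct)
  case (1 x N)
  then show ?case using sum_residue_coeff[of "{..<N}" x] by simp
next
  case (3 x N l)
  have inj: "inj_on x {..<N}" using "3.prems"(1) by (rule inj_on_subset) auto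
  have nz: "\<forall>i<N. x i \<noteq> 0" using "3.prems"(2) by simp
  let ?A = "residue_coeff {..<Suc N} x" and ?B = "residue_coeff {..<N} x"
  have A: "?A i * (x i - x N) = ?B i * (x i + x N)" if "i < N" for i
  proof -
    have "{..<Suc N} - {i} = insert N ({..<N} - {i})" using that by auto
    moreover have "x i \<noteq> x N" using "3.prems"(1) that by (auto simp: inj_on_def)
    ultimately show ?thesis unfolding residue_coeff_def by simp
  qed
  have "(\<Sum>i<Suc N. 2 * ?A i * x i ^ Suc l) - x N * (\<Sum>i<Suc N. 2 * ?A i * x i ^ l) =
      (\<Sum>i<Suc N. 2 * (?A i * (x i - x N)) * x i ^ l)"
    unfolding sum_distrib_left sum_subtractf[symmetric]
    by (intro sum.cong refl) (simp add: algebra_simps)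
  also have "\<dots> = (\<Sum>i<N. 2 * (?B i * (x i + x N)) * x i ^ l)"
    by (simp add: A)
  also have "\<dots> = (\<Sum>i<N. 2 * ?B i * x i ^ Suc l) + x N * (\<Sum>i<N. 2 * ?B i * x i ^ l)"
    unfolding sum_distrib_left sum.distrib[symmetric]
    by (intro sum.cong refl) (simp add: algebra_simps)
  finally show ?case
    unfolding "3.IH"(1)[OF "3.prems"] "3.IH"(2)[OF inj nz] "3.IH"(3)[OF inj nz]
    by (simp only: q_coeff.simps diff_eq_eq add_ac)
qed simp

text \<open>
  Adding the sums for the exponents \<open>(a, b + 1)\<close> and \<open>(a + 1, b)\<close> produces a factor \<open>x j + x i\<close>,
  which cancels the denominator of the kernel, and the double sum separates.  For \<open>b = 0\<close> the inner
  sum is constant by \<open>sum_residue_coeff_kernel\<close>.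
\<close>

lemma sum_pair_eq_q_pair:
  fixes x :: "nat \<Rightarrow> 'a::field"
  assumes inj: "inj_on x {..<N}" and nz: "\<forall>i<N. \<forall>j<N. x i + x j \<noteq> 0"
  defines "A \<equiv> residue_coeff {..<N} x"
  shows "(\<Sum>i<N. \<Sum>j<N. 2 * A i * x i ^ a * (2 * A j * x j ^ b) * ((x j - x i) / (x j + x i))) =
    q_pair x N a b"
proof (induction b arbitrary: a)
  have x0: "\<forall>i<N. x i \<noteq> 0" using nz by (metis add_0)
  note q = sum_power_eq_q_coeff[OF inj x0, folded A_def]
  {
    case 0
    have "(\<Sum>j<N. 2 * A j * ((x j - x i) / (x j + x i))) = 1 + (-1) ^ N" if "i < N" for i
    proof -
      have "(\<Prod>j<N. (x i - x j) / (x i + x j)) = 0" using that by (intro prod_zero) auto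
      then show ?thesis
        using sum_residue_coeff_kernel[of "{..<N}" x "x i"] inj x0 nz that by (simp add: A_def)
    qed
    then have "(\<Sum>i<N. 2 * A i * x i ^ a * (\<Sum>j<N. 2 * A j * ((x j - x i) / (x j + x i)))) =
        (\<Sum>i<N. 2 * A i * x i ^ a * (1 + (-1) ^ N))"
      by simp
    also have "\<dots> = (1 + (-1) ^ N) * q_coeff x N a"
      unfolding q[symmetric] sum_distrib_right[symmetric] by (rule mult.commute)
    finally show ?case by (simp add: sum_distrib_left mult.assoc)
  next
    case (Suc b)
    have "(\<Sum>i<N. \<Sum>j<N. 2 * A i * x i ^ a * (2 * A j * x j ^ Suc b) * ((x j - x i) / (x j + x i))) +
        (\<Sum>i<N. \<Sum>j<N. 2 * A i * x i ^ Suc a * (2 * A j * x j ^ b) * ((x j - x i) / (x j + x i))) =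
        (\<Sum>i<N. \<Sum>j<N. 2 * A i * x i ^ a * (2 * A j * x j ^ Suc b) - 2 * A i * x i ^ Suc a * (2 * A j * x j ^ b))"
      unfolding sum.distrib[symmetric]
    proof (intro sum.cong refl)
      fix i j assume "i \<in> {..<N}" "j \<in> {..<N}"
      then have "x j + x i \<noteq> 0" using nz by auto
      then have "(x j + x i) * ((x j - x i) / (x j + x i)) = x j - x i" by simp
      moreover have "2 * A i * x i ^ a * (2 * A j * x j ^ Suc b) * d + 2 * A i * x i ^ Suc a * (2 * A j * x j ^ b) * d
        = 2 * A i * x i ^ a * (2 * A j * x j ^ b) * ((x j + x i) * d)" for d
        by (simp add: algebra_simps)
      ultimately show "2 * A i * x i ^ a * (2 * A j * x j ^ Suc b) * ((x j - x i) / (x j + x i)) +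
         2 * A i * x i ^ Suc a * (2 * A j * x j ^ b) * ((x j - x i) / (x j + x i)) =
         2 * A i * x i ^ a * (2 * A j * x j ^ Suc b) - 2 * A i * x i ^ Suc a * (2 * A j * x j ^ b)"
        by (simp only:) (simp add: algebra_simps)
    qed
    also have "\<dots> = q_coeff x N a * q_coeff x N (Suc b) - q_coeff x N (Suc a) * q_coeff x N b"
      unfolding q[symmetric] sum_product sum_subtractf ..
    finally show ?case
      unfolding Suc.IH by (simp only: q_pair.simps) (simp add: algebra_simps)
  }
qed

lemma sum_image_same_fibres:
  assumes fib: "\<And>a b. a \<in> S \<Longrightarrow> b \<in> S \<Longrightarrow> f a = f b \<longleftrightarrow> r a = r b"
    and val: "\<And>a. a \<in> S \<Longrightarrow> g (f a) = h (r a)"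
  shows "sum g (f ` S) = sum h (r ` S)"
proof (rule sum.reindex_bij_witness[where i = "\<lambda>s. f (inv_into S r s)" and j = "\<lambda>C. r (inv_into S f C)"])
  fix C assume C: "C \<in> f ` S"
  have *: "inv_into S f C \<in> S" "f (inv_into S f C) = C"
    using C by (auto intro: inv_into_into f_inv_into_f)
  have **: "inv_into S r (r (inv_into S f C)) \<in> S" "r (inv_into S r (r (inv_into S f C))) = r (inv_into S f C)"
    using * by (auto intro: inv_into_into f_inv_into_f)
  show "f (inv_into S r (r (inv_into S f C))) = C"
    using fib[OF **(1) *(1)] ** * by simp
  show "r (inv_into S f C) \<in> r ` S" using * by simp
  show "h (r (inv_into S f C)) = g C" using val[OF *(1)] * by simp
next
  fix s assume s: "s \<in> r ` S"
  have *: "inv_into S r s \<in> S" "r (inv_into S r s) = s"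
    using s by (auto intro: inv_into_into f_inv_into_f)
  have **: "inv_into S f (f (inv_into S r s)) \<in> S" "f (inv_into S f (f (inv_into S r s))) = f (inv_into S r s)"
    using * by (auto intro: inv_into_into f_inv_into_f)
  show "r (inv_into S f (f (inv_into S r s))) = s"
    using fib[OF **(1) *(1)] ** * by simp
  show "f (inv_into S r s) \<in> f ` S" using * by simp
qed

text \<open>
  Together with \<open>restrict_permutations\<close> this turns cosets into injections of \<open>{..<m}\<close> into \<open>{..<N}\<close>.
\<close>

lemma coset_eq_iff_restrict_eq:
  fixes m N :: nat
  assumes \<sigma>: "\<sigma> permutes {..<N}" and \<rho>: "\<rho> permutes {..<N}"
  shows "(\<lambda>\<tau>. \<sigma> \<circ> \<tau>) ` {\<tau>. \<tau> permutes {m..<N}} = (\<lambda>\<tau>. \<rho> \<circ> \<tau>) ` {\<tau>. \<tau> permutes {m..<N}} \<longleftrightarrow>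
    restrict \<sigma> {..<m} = restrict \<rho> {..<m}" (is "?C \<sigma> = ?C \<rho> \<longleftrightarrow> _")
proof
  assume "?C \<sigma> = ?C \<rho>"
  moreover have "\<sigma> \<in> ?C \<sigma>" using permutes_id by (intro image_eqI[of _ _ id]) auto
  ultimately have "\<sigma> \<in> ?C \<rho>" by (simp only:)
  then obtain \<tau> where \<tau>: "\<tau> permutes {m..<N}" and eq: "\<sigma> = \<rho> \<circ> \<tau>" by blast
  have "\<tau> i = i" if "i < m" for i
    using permutes_not_in[OF \<tau>, of i] that by auto
  then show "restrict \<sigma> {..<m} = restrict \<rho> {..<m}"
    unfolding eq by (intro restrict_ext) simp
next
  assume eq: "restrict \<sigma> {..<m} = restrict \<rho> {..<m}"
  have sub: "?C \<sigma> \<subseteq> ?C \<rho>"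
    if \<sigma>: "\<sigma> permutes {..<N}" and \<rho>: "\<rho> permutes {..<N}"
      and eq: "restrict \<sigma> {..<m} = restrict \<rho> {..<m}" for \<sigma> \<rho>
  proof -
    have agree: "\<sigma> i = \<rho> i" if "i < m" for i
      using fun_cong[OF eq, of i] that by simp
    have \<tau>: "inv \<rho> \<circ> \<sigma> permutes {m..<N}"
    proof (rule permutes_superset)
      show "inv \<rho> \<circ> \<sigma> permutes {..<N}"
        using \<sigma> \<rho> by (intro permutes_compose permutes_inv)
      fix i assume "i \<in> {..<N} - {m..<N}"
      then have "i < m" by auto
      then show "(inv \<rho> \<circ> \<sigma>) i = i" by (simp add: agree permutes_inverses(2)[OF \<rho>])
    qed
    have \<sigma>_eq: "\<sigma> = \<rho> \<circ> (inv \<rho> \<circ> \<sigma>)"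
      by (simp add: fun_eq_iff permutes_inverses(1)[OF \<rho>])
    show ?thesis
    proof
      fix \<pi> assume "\<pi> \<in> ?C \<sigma>"
      then obtain \<theta> where \<theta>: "\<theta> permutes {m..<N}" and \<pi>: "\<pi> = \<sigma> \<circ> \<theta>" by blast
      have "\<pi> = \<rho> \<circ> ((inv \<rho> \<circ> \<sigma>) \<circ> \<theta>)"
        unfolding \<pi> by (subst \<sigma>_eq) (simp only: comp_assoc)
      moreover have "(inv \<rho> \<circ> \<sigma>) \<circ> \<theta> permutes {m..<N}"
        using \<theta> \<tau> by (rule permutes_compose)
      ultimately show "\<pi> \<in> ?C \<rho>" by blast
    qed
  qed
  show "?C \<sigma> = ?C \<rho>"
    using sub[OF \<sigma> \<rho> eq] sub[OF \<rho> \<sigma> eq[symmetric]] by (rule equalityI)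
qed

lemma restrict_permutations:
  fixes m N :: nat
  assumes "m \<le> N"
  shows "(\<lambda>\<sigma>. restrict \<sigma> {..<m}) ` {\<sigma>. \<sigma> permutes {..<N}} =
    {s \<in> {..<m} \<rightarrow>\<^sub>E {..<N}. inj_on s {..<m}}"
proof (intro equalityI subsetI)
  fix s assume "s \<in> (\<lambda>\<sigma>. restrict \<sigma> {..<m}) ` {\<sigma>. \<sigma> permutes {..<N}}"
  then obtain \<sigma> where \<sigma>: "\<sigma> permutes {..<N}" and s: "s = restrict \<sigma> {..<m}" by auto
  have "\<sigma> i < N" if "i < m" for i
  proof -
    have "i < N" using that assms by linarith
    then show ?thesis using permutes_in_image[OF \<sigma>, of i] by simp
  qed
  moreover have "inj_on \<sigma> {..<m}" by (rule permutes_inj_on[OF \<sigma>])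
  ultimately show "s \<in> {s \<in> {..<m} \<rightarrow>\<^sub>E {..<N}. inj_on s {..<m}}"
    unfolding s by (auto simp: inj_on_def)
next
  fix s assume "s \<in> {s \<in> {..<m} \<rightarrow>\<^sub>E {..<N}. inj_on s {..<m}}"
  then have s: "s \<in> {..<m} \<rightarrow>\<^sub>E {..<N}" and inj: "inj_on s {..<m}" by auto
  have sN: "s ` {..<m} \<subseteq> {..<N}" using s by auto
  have "card ({..<N} - {..<m}) = card ({..<N} - s ` {..<m})"
    using assms sN inj by (simp add: card_Diff_subset card_image)
  then obtain g where g: "bij_betw g ({..<N} - {..<m}) ({..<N} - s ` {..<m})"
    using finite_same_card_bij[of "{..<N} - {..<m}" "{..<N} - s ` {..<m}"] by auto
  define \<sigma> where "\<sigma> = (\<lambda>i. if i < m then s i else if i < N then g i else i)"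
  have "bij_betw \<sigma> ({..<m} \<union> ({..<N} - {..<m})) (s ` {..<m} \<union> ({..<N} - s ` {..<m}))"
  proof (rule bij_betw_combine)
    show "bij_betw \<sigma> {..<m} (s ` {..<m})"
      using inj by (auto simp: bij_betw_def \<sigma>_def inj_on_def)
    have "bij_betw \<sigma> ({..<N} - {..<m}) ({..<N} - s ` {..<m}) = bij_betw g ({..<N} - {..<m}) ({..<N} - s ` {..<m})"
      by (rule bij_betw_cong) (auto simp: \<sigma>_def)
    then show "bij_betw \<sigma> ({..<N} - {..<m}) ({..<N} - s ` {..<m})" using g by simp
  qed auto
  moreover have "{..<m} \<union> ({..<N} - {..<m}) = {..<N}" using assms by auto
  moreover have "s ` {..<m} \<union> ({..<N} - s ` {..<m}) = {..<N}" using sN by auto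
  ultimately have "bij_betw \<sigma> {..<N} {..<N}" by simp
  then have "\<sigma> permutes {..<N}"
    using assms by (intro bij_imp_permutes) (auto simp: \<sigma>_def)
  moreover have "restrict \<sigma> {..<m} = s"
    using s by (auto simp: \<sigma>_def fun_eq_iff restrict_def PiE_def extensional_def)
  ultimately show "s \<in> (\<lambda>\<sigma>. restrict \<sigma> {..<m}) ` {\<sigma>. \<sigma> permutes {..<N}}" by auto
qed

text \<open>
  The residue coefficient at \<open>x (\<sigma> i)\<close> is a product over all \<open>j \<noteq> i\<close>, while the summand of \<open>Q\<^sub>\<lambda>\<close> has
  only the factors with \<open>i < j\<close>.  The kernel at the inverse variables cancels the surplus factors
  with \<open>j < i\<close>, because \<open>(1/s - 1/t) / (1/s + 1/t) = (t - s) / (t + s)\<close>.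
\<close>

lemma schur_Q_term_eq:
  assumes m: "length la = m" "m \<le> N" and \<sigma>: "\<sigma> permutes {..<N}"
    and inj: "inj x" and nz: "\<And>i j. x i + x j \<noteq> 0"
  shows "schur_Q_term la N (x \<circ> \<sigma>) =
     (\<Prod>i<m. residue_coeff {..<N} x (\<sigma> i) * x (\<sigma> i) ^ (la ! i)) *
     schur_kernel (\<lambda>i. inverse (x (\<sigma> i))) {..<m}"
proof -
  have x0: "x i \<noteq> 0" for i using nz[of i i] by auto
  let ?R = "\<lambda>i j. (x (\<sigma> i) + x (\<sigma> j)) / (x (\<sigma> i) - x (\<sigma> j))"
  have coeff: "residue_coeff {..<N} x (\<sigma> i) = (\<Prod>j<i. ?R i j) * (\<Prod>j\<in>{i<..<N}. ?R i j)" if "i < m" for i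
  proof -
    have "\<sigma> ` ({..<N} - {i}) = {..<N} - {\<sigma> i}"
      using permutes_inj[OF \<sigma>] permutes_image[OF \<sigma>] by (simp add: image_set_diff)
    then have "residue_coeff {..<N} x (\<sigma> i) = (\<Prod>j\<in>{..<N} - {i}. ?R i j)"
      unfolding residue_coeff_def
      by (intro prod.reindex_cong[OF permutes_inj_on[OF \<sigma>]]) auto
    also have "{..<N} - {i} = {..<i} \<union> {i<..<N}" using that m by auto
    also have "(\<Prod>j\<in>{..<i} \<union> {i<..<N}. ?R i j) = (\<Prod>j<i. ?R i j) * (\<Prod>j\<in>{i<..<N}. ?R i j)"
      by (rule prod.union_disjoint) auto
    finally show ?thesis .
  qed
  have "(\<Prod>i<m. \<Prod>j<i. ?R i j) = (\<Prod>j<m. \<Prod>i\<in>{i\<in>{..<m}. j < i}. ?R i j)"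
  proof -
    have "(\<Prod>i<m. \<Prod>j<i. ?R i j) = (\<Prod>i<m. \<Prod>j\<in>{j\<in>{..<m}. j < i}. ?R i j)"
      by (intro prod.cong) auto
    also have "\<dots> = (\<Prod>j<m. \<Prod>i\<in>{i\<in>{..<m}. j < i}. ?R i j)"
      by (rule prod.swap_restrict) auto
    finally show ?thesis .
  qed
  moreover have "(\<Prod>j<m. \<Prod>i\<in>{i\<in>{..<m}. j < i}. ?R i j) * schur_kernel (\<lambda>i. inverse (x (\<sigma> i))) {..<m} = 1"
    unfolding schur_kernel_def prod.distrib[symmetric]
  proof (intro prod.neutral ballI)
    fix j i assume "i \<in> {i \<in> {..<m}. j < i}"
    then have "x (\<sigma> i) \<noteq> x (\<sigma> j)"
      using inj permutes_inj[OF \<sigma>] by (auto dest: injD)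
    then show "?R i j * ((inverse (x (\<sigma> j)) - inverse (x (\<sigma> i))) / (inverse (x (\<sigma> j)) + inverse (x (\<sigma> i)))) = 1"
      using x0[of "\<sigma> i"] x0[of "\<sigma> j"] nz[of "\<sigma> i" "\<sigma> j"] by (simp add: divide_simps)
  qed
  ultimately have key: "(\<Prod>i<m. \<Prod>j<i. ?R i j) * schur_kernel (\<lambda>i. inverse (x (\<sigma> i))) {..<m} = 1"
    by simp
  have "(\<Prod>i<m. residue_coeff {..<N} x (\<sigma> i) * x (\<sigma> i) ^ (la ! i)) =
      (\<Prod>i<m. \<Prod>j<i. ?R i j) * (\<Prod>i<m. \<Prod>j\<in>{i<..<N}. ?R i j) * (\<Prod>i<m. x (\<sigma> i) ^ (la ! i))"
    using coeff by (simp add: prod.distrib)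
  then show ?thesis
    using key m by (simp add: schur_Q_term_def mult_ac)
qed

lemma schur_Q_ratfun_eq_kernel_sum:
  assumes m: "length la = m" "m \<le> N"
  defines "x \<equiv> \<lambda>i. to_ratfun (mvar i)"
  assumes inj: "inj x" and nz: "\<And>i j. x i + x j \<noteq> 0"
  shows "schur_Q_ratfun la N =
     kernel_sum {..<N} (\<lambda>p. inverse (x p)) (\<lambda>i p. 2 * residue_coeff {..<N} x p * x p ^ (la ! i)) {..<m}"
proof -
  let ?h = "\<lambda>s. (\<Prod>i<m. residue_coeff {..<N} x (s i) * x (s i) ^ (la ! i)) *
      schur_kernel (\<lambda>i. inverse (x (s i))) {..<m}"
  have "(\<Sum>C\<in>sym_cosets m N. schur_Q_summand la N C) =
      sum ?h ((\<lambda>\<sigma>. restrict \<sigma> {..<m}) ` {\<sigma>. \<sigma> permutes {..<N}})"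
    unfolding sym_cosets_def
  proof (rule sum_image_same_fibres)
    fix \<sigma> \<rho> assume "\<sigma> \<in> {\<sigma>. \<sigma> permutes {..<N}}" "\<rho> \<in> {\<sigma>. \<sigma> permutes {..<N}}"
    then show "(\<lambda>\<tau>. \<sigma> \<circ> \<tau>) ` {\<tau>. \<tau> permutes {m..<N}} = (\<lambda>\<tau>. \<rho> \<circ> \<tau>) ` {\<tau>. \<tau> permutes {m..<N}} \<longleftrightarrow>
      restrict \<sigma> {..<m} = restrict \<rho> {..<m}"
      by (simp add: coset_eq_iff_restrict_eq)
  next
    fix \<sigma> assume "\<sigma> \<in> {\<sigma>. \<sigma> permutes {..<N}}"
    then have \<sigma>: "\<sigma> permutes {..<N}" by simp
    have "schur_Q_summand la N ((\<lambda>\<tau>. \<sigma> \<circ> \<tau>) ` {\<tau>. \<tau> permutes {m..<N}}) = schur_Q_term la N (x \<circ> \<sigma>)"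
      using schur_Q_summand_coset[OF \<sigma>, of la] m(1) by (simp add: x_def comp_def)
    also have "\<dots> = ?h \<sigma>" by (rule schur_Q_term_eq[OF m \<sigma> inj nz])
    also have "\<dots> = ?h (restrict \<sigma> {..<m})"
      by (intro arg_cong2[where f = "(*)"] prod.cong schur_kernel_cong) auto
    finally show "schur_Q_summand la N ((\<lambda>\<tau>. \<sigma> \<circ> \<tau>) ` {\<tau>. \<tau> permutes {m..<N}}) = ?h (restrict \<sigma> {..<m})" .
  qed
  also have "\<dots> = sum ?h ({..<m} \<rightarrow>\<^sub>E {..<N})"
    unfolding restrict_permutations[OF m(2)]
  proof (rule sum.mono_neutral_left)
    show "finite ({..<m} \<rightarrow>\<^sub>E {..<N})" by (simp add: finite_PiE)
    show "\<forall>s\<in>({..<m} \<rightarrow>\<^sub>E {..<N}) - {s \<in> {..<m} \<rightarrow>\<^sub>E {..<N}. inj_on s {..<m}}. ?h s = 0"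
    proof
      fix s assume "s \<in> ({..<m} \<rightarrow>\<^sub>E {..<N}) - {s \<in> {..<m} \<rightarrow>\<^sub>E {..<N}. inj_on s {..<m}}"
      then obtain a b where "a \<in> {..<m}" "b \<in> {..<m}" "a \<noteq> b" "s a = s b"
        by (auto simp: inj_on_def)
      then have "schur_kernel (\<lambda>i. inverse (x (s i))) {..<m} = 0"
        by (intro schur_kernel_eq_0[of _ a b]) auto
      then show "?h s = 0" by simp
    qed
  qed auto
  finally have "schur_Q_ratfun la N = 2 ^ m * sum ?h ({..<m} \<rightarrow>\<^sub>E {..<N})"
    by (simp add: schur_Q_ratfun_def m)
  then show ?thesis
    by (simp add: kernel_sum_def sum_distrib_left prod.distrib mult.assoc)
qed

text \<open>
  The Pfaffian on the right is a polynomial by construction, so the lemma also shows that the sum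
  of rational functions defining \<open>Q\<^sub>\<lambda>\<close> is a polynomial.
\<close>

lemma schur_Q_eq_pfaffian:
  assumes m: "length la = m" "m \<le> N"
  shows "schur_Q la N = pfaffian (\<lambda>i j. q_pair mvar N (la ! i) (la ! j)) (\<lambda>i. q_coeff mvar N (la ! i)) {..<m}"
proof (rule schur_Q_eqI)
  define x where "x = (\<lambda>i. to_ratfun (mvar i))"
  have inj: "inj x"
    unfolding x_def by (rule injI) (simp add: to_ratfun_inject inj_eq[OF inj_mvar])
  have nz: "x i + x j \<noteq> 0" for i j
    using mvar_add_neq_0[of i j] unfolding x_def to_ratfun.add[symmetric]
    by (metis to_ratfun.zero to_ratfun_inject)
  have x0: "x i \<noteq> 0" for i using nz[of i i] by auto
  have injN: "inj_on x {..<N}" using inj by (rule inj_on_subset) simp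
  let ?u = "\<lambda>i p. 2 * residue_coeff {..<N} x p * x p ^ (la ! i)"
  have recip: "(inverse (x p) - inverse (x q)) / (inverse (x p) + inverse (x q)) = (x q - x p) / (x q + x p)" for p q
    using x0[of p] x0[of q] nz[of p q] nz[of q p] by (simp add: divide_simps)
  have "to_ratfun (pfaffian (\<lambda>i j. q_pair mvar N (la ! i) (la ! j)) (\<lambda>i. q_coeff mvar N (la ! i)) {..<m}) =
      pfaffian (\<lambda>i j. q_pair x N (la ! i) (la ! j)) (\<lambda>i. q_coeff x N (la ! i)) {..<m}"
    unfolding to_ratfun.pfaffian to_ratfun.q_pair to_ratfun.q_coeff x_def ..
  also have "\<dots> = kernel_sum {..<N} (\<lambda>p. inverse (x p)) ?u {..<m}"
  proof (rule kernel_sum_eq_pfaffian)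
    show "\<forall>p\<in>{..<N}. \<forall>q\<in>{..<N}. inverse (x p) + inverse (x q) \<noteq> 0"
    proof (intro ballI)
      fix p q
      have "(inverse (x p) + inverse (x q)) * (x p * x q) = x q + x p"
        using x0[of p] x0[of q] by (simp add: field_simps)
      then show "inverse (x p) + inverse (x q) \<noteq> 0" using nz[of q p] by auto
    qed
    show "q_coeff x N (la ! i) = (\<Sum>p<N. ?u i p)" for i
      using sum_power_eq_q_coeff[OF injN, of "la ! i"] x0 by simp
    show "q_pair x N (la ! i) (la ! j) = (\<Sum>p<N. \<Sum>q<N. ?u i p * ?u j q *
       ((inverse (x p) - inverse (x q)) / (inverse (x p) + inverse (x q))))" for i j
      unfolding recip using sum_pair_eq_q_pair[OF injN, of "la ! i" "la ! j"] nz by simp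
  qed simp
  also have "\<dots> = schur_Q_ratfun la N"
    using schur_Q_ratfun_eq_kernel_sum[OF m] inj nz unfolding x_def by simp
  finally show "to_ratfun (pfaffian (\<lambda>i j. q_pair mvar N (la ! i) (la ! j)) (\<lambda>i. q_coeff mvar N (la ! i)) {..<m}) =
    schur_Q_ratfun la N" .
qed

section \<open>One and two rows at equal variables\<close>

text \<open>
  At equal variables the recursion of \<open>q_coeff\<close> is that of the Delannoy numbers, with other boundary
  values.
\<close>

abbreviation q1 :: "nat \<Rightarrow> nat \<Rightarrow> real" where "q1 \<equiv> q_coeff (\<lambda>_. 1)"

lemma q_coeff_0_left: "q_coeff x 0 l = 0"
  by (cases l) auto

lemma q1_1: "q1 (Suc 0) l = 2"
  by (induction l) (auto simp: q_coeff_0_left)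

lemma q1_2: "q1 (Suc (Suc 0)) l = 4 * real l"
  by (induction l) (auto simp: q1_1 q_coeff_0_left)

text \<open>
  The difference of the sides satisfies the recursion \<open>f (N + 1) (l + 1) = f (N + 1) l + f N (l + 1) + f N l\<close>
  of \<open>q1\<close> and vanishes for \<open>l = 0\<close> and for one variable.
\<close>

lemma q1_recurrence:
  "2 * real l * q1 (Suc N) l = real (Suc N) * (q1 (Suc (Suc N)) l - q1 N l)"
proof (induction N arbitrary: l)
  case 0
  show ?case by (simp add: q1_1 q1_2 q_coeff_0_left)
next
  case (Suc N)
  note IH = Suc.IH
  show ?case
  proof (induction l)
    case 0
    show ?case by simp
  next
    case (Suc l)
    show ?case
      using Suc IH[of l] IH[of "Suc l"] by (simp add: algebra_simps)
  qed
qed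

text \<open>
  Induction on \<open>b\<close> along the recursion of \<open>q_pair\<close>.  With \<open>N' = Suc N\<close> and \<open>l = q1 N'\<close>, the recurrence
  of \<open>q1\<close> amounts to the first-order system \<open>(c + 1) * l (c + 1) = N' * (e c + l c)\<close> and
  \<open>c * l c = N' * (e (c + 1) - l (c + 1))\<close>, by which the induction step is an algebraic identity.
\<close>

lemma q1_pair_closed_form:
  fixes N defines "e \<equiv> \<lambda>a. (q1 (Suc (Suc N)) a + q1 N a) / 2"
  shows "real (a + b) * q_pair (\<lambda>_. 1) (Suc N) a b =
     real a * q1 (Suc N) a * e b - real b * q1 (Suc N) b * e a"
proof (induction b arbitrary: a)
  case 0
  show ?case by (simp add: e_def)
next
  case (Suc b)
  let ?l = "q1 (Suc N)"
  have up: "real (Suc c) * ?l (Suc c) = real (Suc N) * (e c + ?l c)" for c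
    using q1_recurrence[of "Suc c" N] by (simp add: e_def field_simps)
  have e: "real (Suc N) * (e (Suc c) - ?l (Suc c)) = real c * ?l c" for c
    using q1_recurrence[of c N] by (simp add: e_def field_simps)
  let ?M = "real (Suc N)"
  have "?M * (real a * ?l a * e (Suc b) - real (Suc b) * ?l (Suc b) * e a) =
     ?M * ((real (a + Suc b)) * (?l a * ?l (Suc b) - ?l (Suc a) * ?l b)
      - (real (Suc a) * ?l (Suc a) * e b - real b * ?l b * e (Suc a)))"
    using up[of a] up[of b] e[of a] e[of b] unfolding of_nat_add of_nat_Suc
    by algebra
  moreover have "?M \<noteq> 0" by simp
  ultimately have "real a * ?l a * e (Suc b) - real (Suc b) * ?l (Suc b) * e a =
     (real (a + Suc b)) * (?l a * ?l (Suc b) - ?l (Suc a) * ?l b)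
      - (real (Suc a) * ?l (Suc a) * e b - real b * ?l b * e (Suc a))"
    using mult_left_cancel by blast
  then show ?case
    using Suc.IH[of "Suc a"]
    by (simp only: q_pair.simps right_diff_distrib add_Suc_right add_Suc)
qed

section \<open>The hypergeometric weights\<close>

text \<open>
  The factor depending on \<open>N\<close> but not on \<open>\<lambda>\<close> in the summand of the theorem, including one factor
  \<open>2 * N = 2 * n + 2\<close>; see \<open>weight_eq_pochhammer\<close>.  The argument is a real number so that shifts of it
  by \<open>1\<close> in both directions cause no case distinctions.
\<close>

fun weight :: "real \<Rightarrow> nat \<Rightarrow> real" where
  "weight x 0 = 2 * x"
| "weight x (Suc k) = weight x k * (2 * ((real k + 1)\<^sup>2 - x\<^sup>2) / ((real k + 1) * (2 * real k + 3)))"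

text \<open>
  Up to a factor depending only on \<open>k\<close>, \<open>weight x k\<close> is the product of the \<open>2 * k + 1\<close> consecutive
  numbers \<open>x - k, \<dots>, x + k\<close>.  Hence \<open>weight (x + 1) (k + 1)\<close> and \<open>weight x k\<close> share all but two factors.
\<close>

lemma weight_shift_up:
  "weight (x + 1) (Suc k) =
   - weight x k * (2 * (x + real k + 1) * (x + real k + 2) / ((real k + 1) * (2 * real k + 3)))"
proof (induction k)
  case 0
  show ?case by (simp add: field_simps power2_eq_square)
next
  case (Suc k)
  show ?case
    unfolding weight.simps(2)[of "x + 1" "Suc k"] Suc.IH weight.simps(2)[of x k] of_nat_Suc
    by (simp add: divide_simps) (rule disjI2, algebra)
qed

lemma weight_uminus: "weight (- x) k = - weight x k"
  by (induction k) auto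

lemma weight_shift_down:
  "weight (x - 1) (Suc k) =
   - weight x k * (2 * (x - real k - 1) * (x - real k - 2) / ((real k + 1) * (2 * real k + 3)))"
proof -
  have "weight (x - 1) (Suc k) = - weight (- x + 1) (Suc k)"
    using weight_uminus[of "x - 1" "Suc k"] by (simp only: minus_diff_eq) simp
  also have "\<dots> = - weight x k *
      (2 * (- x + real k + 1) * (- x + real k + 2) / ((real k + 1) * (2 * real k + 3)))"
    unfolding weight_shift_up weight_uminus by simp
  also have "2 * (- x + real k + 1) * (- x + real k + 2) = 2 * (x - real k - 1) * (x - real k - 2)"
    by algebra
  finally show ?thesis .
qed

lemma weight_eq_0: "N \<le> k \<Longrightarrow> weight (real N) k = 0"
proof (induction k)
  case (Suc k)
  then show ?case by (cases "N = Suc k") (auto simp: add.commute)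
qed simp

text \<open>
  The coefficientwise form of \<open>q1_recurrence\<close>: by \<open>sum_binom_half_step\<close> the bracket on the right
  consists of the coefficients of \<open>a\<close> times the sum.
\<close>

lemma weight_difference:
  "x * (weight (x + 1) k - weight (x - 1) k) =
     2 * ((2 * real k + 1) * weight x k - 2 * real k * weight x (k - 1))"
proof (cases k)
  case (Suc i)
  show ?thesis
    unfolding Suc weight_shift_up weight_shift_down diff_Suc_1 unfolding weight.simps(2)
    by (simp add: divide_simps) algebra
qed simp

text \<open>
  Up to the sign \<open>(-1)\<^sup>k\<close> this is the binomial coefficient of \<open>(a - 1) / 2\<close> over \<open>k\<close>.
\<close>

definition binom_half :: "nat \<Rightarrow> nat \<Rightarrow> real" where
  "binom_half a k = pochhammer ((1 - real a) / 2) k / fact k"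

lemma binom_half_step:
  "real a * binom_half a k = (2 * real k + 1) * binom_half a k - 2 * (real k + 1) * binom_half a (Suc k)"
  by (simp add: binom_half_def pochhammer_Suc divide_simps) algebra

lemma sum_binom_half_step:
  "real a * (\<Sum>k\<le>K. u k * binom_half a k) =
   (\<Sum>k\<le>K. ((2 * real k + 1) * u k - 2 * real k * u (k - 1)) * binom_half a k)
     - 2 * (real K + 1) * u K * binom_half a (Suc K)"
proof (induction K)
  case 0
  have "u 0 * (real a * binom_half a 0) = u 0 * (binom_half a 0 - 2 * binom_half a (Suc 0))"
    unfolding binom_half_step by simp
  then show ?case by (simp add: algebra_simps)
next
  case (Suc K)
  have "u (Suc K) * (real a * binom_half a (Suc K)) = u (Suc K) *
     ((2 * real (Suc K) + 1) * binom_half a (Suc K) - 2 * (real (Suc K) + 1) * binom_half a (Suc (Suc K)))"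
    unfolding binom_half_step ..
  then show ?case
    using Suc.IH by (simp add: algebra_simps)
qed

text \<open>
  The sums satisfy \<open>q1_recurrence\<close>, which determines all \<open>q1 N a\<close> from \<open>N = 0\<close> and \<open>N = 1\<close>.  Summing up
  to an arbitrary \<open>K \<ge> N\<close> lets one range serve several values of \<open>N\<close>, and makes the boundary term of
  \<open>sum_binom_half_step\<close> vanish.
\<close>

lemma sum_weight_eq_q1:
  assumes "N \<le> K"
  shows "(\<Sum>k\<le>K. weight (real N) k * binom_half a k) = q1 N a"
  using assms
proof (induction N rule: less_induct)
  case (less N)
  consider "N = 0" | "N = 1" | M where "N = Suc (Suc M)"
    by (metis One_nat_def not0_implies_Suc)
  then show ?case
  proof cases
    case 1
    have "weight 0 k = 0" for k using weight_eq_0[of 0 k] by simp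
    then show ?thesis using 1 by (simp add: q_coeff_0_left)
  next
    case 2
    have "(\<Sum>k\<le>K. weight (real N) k * binom_half a k) = weight 1 0 * binom_half a 0"
      using 2 weight_eq_0[of 1] by (intro sum.mono_neutral_cong_right[where S = "{0}", simplified])
        (auto simp: weight_eq_0[of 1, simplified])
    then show ?thesis using 2 by (simp add: binom_half_def q1_1)
  next
    case 3
    let ?r = "\<lambda>N. \<Sum>k\<le>K. weight (real N) k * binom_half a k"
    have "real (Suc M) * (?r N - ?r M) =
        (\<Sum>k\<le>K. (real (Suc M) * (weight (real (Suc M) + 1) k - weight (real (Suc M) - 1) k)) * binom_half a k)"
      by (simp add: 3 sum_distrib_left sum_subtractf algebra_simps)
    also have "\<dots> = 2 * (real a * ?r (Suc M))"
      using weight_eq_0[of "Suc M" K] less.prems 3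
      unfolding weight_difference sum_binom_half_step
      by (simp add: sum_distrib_left mult.assoc right_diff_distrib left_diff_distrib del: of_nat_Suc)
    also have "\<dots> = 2 * real a * q1 (Suc M) a"
      using less.IH[of "Suc M"] less.prems 3 by simp
    also have "\<dots> = real (Suc M) * (q1 N a - q1 M a)"
      unfolding 3 by (rule q1_recurrence)
    finally have "?r N - ?r M = q1 N a - q1 M a"
      by (subst (asm) mult_left_cancel) auto
    then show ?thesis using less.IH[of M] less.prems 3 by simp
  qed
qed

text \<open>
  The coefficientwise form of \<open>q1_pair_closed_form\<close>: the left side consists of the coefficients of
  \<open>a + b\<close> times the double sum, \<open>\<alpha>\<close> of those of \<open>a\<close> times the single sum, and \<open>\<epsilon>\<close> of those of \<open>e\<close>.
  All values of \<open>weight\<close> can be expressed by those at \<open>x\<close> and \<open>k - 1\<close>, \<open>l - 1\<close>, which leaves an identity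
  of rational functions.
\<close>

lemma kernel_coefficient_identity:
  fixes x :: real
  defines "w \<equiv> weight x"
  defines "M \<equiv> \<lambda>k l. w k * w l * ((real k - real l) / (real k + real l + 1))"
  defines "\<alpha> \<equiv> \<lambda>k. (2 * real k + 1) * w k - 2 * real k * w (k - 1)"
  defines "\<epsilon> \<equiv> \<lambda>k. (weight (x + 1) k + weight (x - 1) k) / 2"
  shows "((2 * real k + 1) * M k l - 2 * real k * M (k - 1) l) +
         ((2 * real l + 1) * M k l - 2 * real l * M k (l - 1)) = \<alpha> k * \<epsilon> l - \<epsilon> k * \<alpha> l"
proof -
  have eps: "\<epsilon> (Suc i) = w (Suc i) - 2 * w i" for i
    unfolding \<epsilon>_def w_def weight_shift_up weight_shift_down unfolding weight.simps(2)
    by (simp add: divide_simps) algebra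
  have eps0: "\<epsilon> 0 = w 0" by (simp add: \<epsilon>_def w_def)
  show ?thesis
  proof (cases k; cases l)
    assume "k = 0" "l = 0"
    then show ?thesis by (simp add: M_def eps0)
  next
    fix j assume k: "k = 0" and l: "l = Suc j"
    show ?thesis
      by (simp add: k l eps eps0 \<alpha>_def M_def divide_simps) algebra
  next
    fix i assume k: "k = Suc i" and l: "l = 0"
    show ?thesis
      by (simp add: k l eps eps0 \<alpha>_def M_def divide_simps) algebra
  next
    fix i j assume k: "k = Suc i" and l: "l = Suc j"
    have w: "w (Suc i) = w i * (2 * ((real i + 1)\<^sup>2 - x\<^sup>2) / ((real i + 1) * (2 * real i + 3)))" for i
      by (simp add: w_def)
    show ?thesis
      by (simp add: k l eps \<alpha>_def M_def w del: of_nat_Suc, simp add: divide_simps, algebra)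
  qed
qed

text \<open>
  Since \<open>a + b\<close> is cancelled, this says nothing for \<open>a = b = 0\<close>; positivity of the parts of the
  partition enters here.  The bound \<open>K \<ge> N + 2\<close> covers all three indices \<open>N\<close>, \<open>N + 1\<close>, \<open>N + 2\<close>.
\<close>

lemma sum_weight_kernel_eq_q_pair:
  assumes "Suc (Suc N) \<le> K" and ab: "a + b > 0"
  defines "w \<equiv> weight (real (Suc N))"
  shows "(\<Sum>k\<le>K. \<Sum>l\<le>K. w k * binom_half a k * (w l * binom_half b l) *
            ((real k - real l) / (real k + real l + 1))) = q_pair (\<lambda>_. 1) (Suc N) a b"
proof -
  let ?x = "real (Suc N)"
  define M where "M = (\<lambda>k l. w k * w l * ((real k - real l) / (real k + real l + 1)))"
  define \<alpha> where "\<alpha> = (\<lambda>k. (2 * real k + 1) * w k - 2 * real k * w (k - 1))"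
  define \<epsilon> where "\<epsilon> = (\<lambda>k. (weight (?x + 1) k + weight (?x - 1) k) / 2)"
  define e where "e = (\<lambda>a. (q1 (Suc (Suc N)) a + q1 N a) / 2)"
  define R where "R = (\<Sum>k\<le>K. \<Sum>l\<le>K. M k l * binom_half a k * binom_half b l)"
  have wK: "w K = 0" using assms by (simp add: weight_eq_0 del: of_nat_Suc)
  have \<alpha>_sum: "(\<Sum>k\<le>K. \<alpha> k * binom_half c k) = real c * q1 (Suc N) c" for c
    using sum_binom_half_step[of c w K] sum_weight_eq_q1[of "Suc N" K c] assms(1) wK
    by (simp add: \<alpha>_def w_def del: of_nat_Suc)
  have \<epsilon>_sum: "(\<Sum>k\<le>K. \<epsilon> k * binom_half c k) = e c" for c
  proof -
    have "(\<Sum>k\<le>K. \<epsilon> k * binom_half c k) =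
      ((\<Sum>k\<le>K. weight (?x + 1) k * binom_half c k) + (\<Sum>k\<le>K. weight (?x - 1) k * binom_half c k)) / 2"
      by (simp add: \<epsilon>_def sum.distrib[symmetric] sum_divide_distrib distrib_right add_divide_distrib)
    moreover have "?x + 1 = real (Suc (Suc N))" "?x - 1 = real N" by simp_all
    ultimately show ?thesis
      using sum_weight_eq_q1[of N K c] sum_weight_eq_q1[of "Suc (Suc N)" K c] assms(1)
      by (simp only: e_def)
  qed
  have ra: "real a * R = (\<Sum>k\<le>K. \<Sum>l\<le>K. ((2 * real k + 1) * M k l - 2 * real k * M (k - 1) l)
      * binom_half a k * binom_half b l)"
  proof -
    have "real a * R = (\<Sum>l\<le>K. real a * (\<Sum>k\<le>K. M k l * binom_half a k) * binom_half b l)"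
      unfolding R_def by (subst sum.swap) (simp add: sum_distrib_left sum_distrib_right mult.assoc)
    also have "\<dots> = (\<Sum>l\<le>K. (\<Sum>k\<le>K. ((2 * real k + 1) * M k l - 2 * real k * M (k - 1) l)
        * binom_half a k) * binom_half b l)"
      unfolding sum_binom_half_step by (simp add: M_def wK)
    also have "\<dots> = (\<Sum>k\<le>K. \<Sum>l\<le>K. ((2 * real k + 1) * M k l - 2 * real k * M (k - 1) l)
        * binom_half a k * binom_half b l)"
      by (subst sum.swap) (simp add: sum_distrib_right)
    finally show ?thesis .
  qed
  have rb: "real b * R = (\<Sum>k\<le>K. \<Sum>l\<le>K. ((2 * real l + 1) * M k l - 2 * real l * M k (l - 1))
      * binom_half a k * binom_half b l)"
  proof -
    have "real b * R = (\<Sum>k\<le>K. real b * (\<Sum>l\<le>K. M k l * binom_half b l) * binom_half a k)"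
      unfolding R_def by (simp add: sum_distrib_left sum_distrib_right mult.assoc) (simp add: mult_ac)
    also have "\<dots> = (\<Sum>k\<le>K. (\<Sum>l\<le>K. ((2 * real l + 1) * M k l - 2 * real l * M k (l - 1))
        * binom_half b l) * binom_half a k)"
      unfolding sum_binom_half_step by (simp add: M_def wK)
    also have "\<dots> = (\<Sum>k\<le>K. \<Sum>l\<le>K. ((2 * real l + 1) * M k l - 2 * real l * M k (l - 1))
        * binom_half a k * binom_half b l)"
      unfolding sum_distrib_right by (intro sum.cong refl) (simp only: mult_ac)
    finally show ?thesis .
  qed
  have "real (a + b) * R = (\<Sum>k\<le>K. \<Sum>l\<le>K. (\<alpha> k * \<epsilon> l - \<epsilon> k * \<alpha> l) * binom_half a k * binom_half b l)"
    unfolding of_nat_add distrib_right ra rb sum.distrib[symmetric]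
    unfolding distrib_right[symmetric] M_def \<alpha>_def \<epsilon>_def w_def
      kernel_coefficient_identity[of _ ?x, symmetric] ..
  also have "\<dots> = (\<Sum>k\<le>K. \<alpha> k * binom_half a k) * (\<Sum>l\<le>K. \<epsilon> l * binom_half b l) -
     (\<Sum>k\<le>K. \<epsilon> k * binom_half a k) * (\<Sum>l\<le>K. \<alpha> l * binom_half b l)"
    unfolding sum_product sum_subtractf[symmetric]
    by (intro sum.cong refl) (simp add: algebra_simps)
  also have "\<dots> = real (a + b) * q_pair (\<lambda>_. 1) (Suc N) a b"
    unfolding \<alpha>_sum \<epsilon>_sum q1_pair_closed_form e_def by simp
  finally have "R = q_pair (\<lambda>_. 1) (Suc N) a b"
    using ab by simp
  then show ?thesis
    by (simp add: R_def M_def mult_ac)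
qed

lemma weight_eq_pochhammer:
  "weight (real n + 1) k = (2 * real n + 2) * (pochhammer (- real n) k * pochhammer (real n + 2) k) /
      (pochhammer 1 k * pochhammer (3 / 2) k)"
proof (induction k)
  case (Suc k)
  have "2 * ((real k + 1)\<^sup>2 - (real n + 1)\<^sup>2) / ((real k + 1) * (2 * real k + 3)) =
    (- real n + real k) * (real n + 2 + real k) / ((1 + real k) * (3 / 2 + real k))"
    by (simp add: divide_simps) algebra
  then show ?case
    unfolding weight.simps(2) Suc.IH pochhammer_Suc
    by (simp add: mult_ac)
qed simp

theorem corollary6p2:
  fixes la :: "nat list" and m n :: nat
  assumes "is_partition la" and "length la = m" and "int n \<ge> int m - 1"
  shows "mveval (schur_Q la (n + 1)) (\<lambda>_. 1) =
    (2 * real n + 2) ^ m *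
    (\<Sum>k \<in> {..<m} \<rightarrow>\<^sub>E {0..n}.
       (\<Prod>i<m. \<Prod>j \<in> {i<..<m}. (real (k i) - real (k j)) / (real (k i) + real (k j) + 1)) *
       (\<Prod>i<m.
          (pochhammer (- real n) (k i) * pochhammer (real n + 2) (k i)
             * pochhammer ((1 - real (la ! i)) / 2) (k i)) /
          (pochhammer 1 (k i) * pochhammer 1 (k i) * pochhammer (3 / 2) (k i))))"
proof -
  let ?N = "Suc n"
  let ?u = "\<lambda>i k. weight (real ?N) k * binom_half (la ! i) k"
  let ?y = "\<lambda>k. real k + 1 / 2"
  have pos: "la ! i > 0" if "i < m" for i
    using assms(1,2) that by (auto simp: is_partition_def)
  have kernel: "(?y k - ?y l) / (?y k + ?y l) = (real k - real l) / (real k + real l + 1)" for k l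
    by simp
  have trunc: "(\<Sum>k\<le>K. weight (real ?N) k * f k) = (\<Sum>k\<in>{0..n}. weight (real ?N) k * f k)"
    if "n \<le> K" for f K
    using weight_eq_0[of ?N] that by (intro sum.mono_neutral_right) auto
  have "mveval (schur_Q la (n + 1)) (\<lambda>_. 1) =
     pfaffian (\<lambda>i j. q_pair (\<lambda>_. 1) ?N (la ! i) (la ! j)) (\<lambda>i. q1 ?N (la ! i)) {..<m}"
    using assms(2,3)
    by (simp add: schur_Q_eq_pfaffian mveval.pfaffian mveval.q_pair mveval.q_coeff mveval_mvar)
  also have "\<dots> = kernel_sum {0..n} ?y ?u {..<m}"
  proof (rule kernel_sum_eq_pfaffian)
    show "\<forall>p\<in>{0..n}. \<forall>q\<in>{0..n}. ?y p + ?y q \<noteq> 0"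
      by (auto simp: add_nonneg_eq_0_iff)
    show "q1 ?N (la ! i) = (\<Sum>p\<in>{0..n}. ?u i p)" for i
      using sum_weight_eq_q1[of ?N ?N "la ! i"] trunc[of ?N] by simp
    fix i j assume "i \<in> {..<m}" "j \<in> {..<m}"
    then have "la ! i + la ! j > 0" using pos by simp
    note pair = sum_weight_kernel_eq_q_pair[of n "Suc ?N", OF order_refl this]
    let ?F = "\<lambda>k l. ?u i k * ?u j l * ((real k - real l) / (real k + real l + 1))"
    have nested: "(\<Sum>k\<in>S. \<Sum>l\<in>S. ?F k l) = (\<Sum>k\<in>S. weight (real ?N) k * (binom_half (la ! i) k *
        (\<Sum>l\<in>S. weight (real ?N) l * (binom_half (la ! j) l * ((real k - real l) / (real k + real l + 1))))))" for S
      unfolding sum_distrib_left by (intro sum.cong refl) (simp only: mult_ac)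
    have "(\<Sum>k\<le>Suc ?N. \<Sum>l\<le>Suc ?N. ?F k l) = (\<Sum>k\<in>{0..n}. \<Sum>l\<in>{0..n}. ?F k l)"
      unfolding nested by (subst (1 2) trunc) simp_all
    then show "q_pair (\<lambda>_. 1) ?N (la ! i) (la ! j) =
      (\<Sum>p\<in>{0..n}. \<Sum>q\<in>{0..n}. ?u i p * ?u j q * ((?y p - ?y q) / (?y p + ?y q)))"
      unfolding kernel pair by (simp only:)
  qed simp
  also have "\<dots> = (\<Sum>k \<in> {..<m} \<rightarrow>\<^sub>E {0..n}. (2 * real n + 2) ^ m *
       ((\<Prod>i<m. \<Prod>j \<in> {i<..<m}. (real (k i) - real (k j)) / (real (k i) + real (k j) + 1)) *
       (\<Prod>i<m.
          (pochhammer (- real n) (k i) * pochhammer (real n + 2) (k i)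
             * pochhammer ((1 - real (la ! i)) / 2) (k i)) /
          (pochhammer 1 (k i) * pochhammer 1 (k i) * pochhammer (3 / 2) (k i)))))"
    unfolding kernel_sum_def
  proof (intro sum.cong refl)
    fix k
    have u: "?u i l = (2 * real n + 2) * ((pochhammer (- real n) l * pochhammer (real n + 2) l
             * pochhammer ((1 - real (la ! i)) / 2) l) /
          (pochhammer 1 l * pochhammer 1 l * pochhammer (3 / 2) l))" for i l
      using weight_eq_pochhammer[of n l]
      by (simp add: binom_half_def add.commute pochhammer_fact[symmetric] mult_ac)
    have "schur_kernel (\<lambda>i. ?y (k i)) {..<m} =
       (\<Prod>i<m. \<Prod>j \<in> {i<..<m}. (real (k i) - real (k j)) / (real (k i) + real (k j) + 1))"
      unfolding schur_kernel_def kernel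
      by (intro prod.cong refl) auto
    moreover have "(\<Prod>i<m. ?u i (k i)) = (2 * real n + 2) ^ m * (\<Prod>i<m.
          (pochhammer (- real n) (k i) * pochhammer (real n + 2) (k i)
             * pochhammer ((1 - real (la ! i)) / 2) (k i)) /
          (pochhammer 1 (k i) * pochhammer 1 (k i) * pochhammer (3 / 2) (k i)))"
      unfolding u by (simp only: prod.distrib prod_constant card_lessThan)
    ultimately show "(\<Prod>i<m. ?u i (k i)) * schur_kernel (\<lambda>i. ?y (k i)) {..<m} = (2 * real n + 2) ^ m *
       ((\<Prod>i<m. \<Prod>j \<in> {i<..<m}. (real (k i) - real (k j)) / (real (k i) + real (k j) + 1)) *
       (\<Prod>i<m.
          (pochhammer (- real n) (k i) * pochhammer (real n + 2) (k i)
             * pochhammer ((1 - real (la ! i)) / 2) (k i)) /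
          (pochhammer 1 (k i) * pochhammer 1 (k i) * pochhammer (3 / 2) (k i))))"
      by (simp only: mult_ac)
  qed
  finally show ?thesis by (simp only: sum_distrib_left)
qed

end
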